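(* Let $T$ be a complete first-order theory in a countable language. If $T$ has an atomic pseudominimal model $M$ of cardinality $\aleph_1$, then $T$ has an atomic pseudominimal model $N$ of cardinality $2^{\aleph_0}$.
   Context: A model $M$ of a complete theory $T$ is atomic if every finite tuple of $M$ satisfies a formula complete with respect to $T$ (i.e., isolating a complete type). For an atomic model $M$ and a finite tuple $\bar b$ from $M$, an element $a\in M$ is pseudo-algebraic over $\bar b$ in $M$, written $a\in{\rm pcl}(\bar b)$, if every elementary substructure $N\preceq M$ containing $\bar b$ also contains $a$. An atomic model $M$ is pseudominimal if ${\rm pcl}$ satisfies exchange on $M$: for every finite $C\subseteq M$ and $a,b\in M$, if $b\in{\rm pcl}(Ca)$ and $b\notin{\rm pcl}(C)$, then $a\in{\rm pcl}(Cb)$. *)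

theory Defs
  imports "HOL-Library.Countable_Set"
begin

unbundle cardinal_syntax

section \<open>First-order languages, formulas and structures\<close>

text \<open>
  The symbols of a language are sets inside the symbol types, so that a language may have no
  function symbols or no relation symbols. Constants are function symbols of arity 0.
\<close>

record ('f, 'r) lang =
  funs :: "'f set"
  rels :: "'r set"
  farity :: "'f \<Rightarrow> nat"
  rarity :: "'r \<Rightarrow> nat"

definition countable_lang :: "('f, 'r) lang \<Rightarrow> bool" where
  "countable_lang L \<longleftrightarrow> countable (funs L) \<and> countable (rels L)"

datatype (funs_tm: 'f) tm = Var nat | Fn 'f "'f tm list"

datatype (funs_fm: 'f, rels_fm: 'r) fm =
    Eq "'f tm" "'f tm"
  | Rel 'r "'f tm list"
  | Neg "('f, 'r) fm"
  | Conj "('f, 'r) fm" "('f, 'r) fm"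
  | Exists nat "('f, 'r) fm"

definition Imp :: "('f, 'r) fm \<Rightarrow> ('f, 'r) fm \<Rightarrow> ('f, 'r) fm" where
  "Imp \<phi> \<psi> = Neg (Conj \<phi> (Neg \<psi>))"

fun fv_tm :: "'f tm \<Rightarrow> nat set" where
  "fv_tm (Var i) = {i}"
| "fv_tm (Fn f ts) = (\<Union>t \<in> set ts. fv_tm t)"

primrec fv :: "('f, 'r) fm \<Rightarrow> nat set" where
  "fv (Eq s t) = fv_tm s \<union> fv_tm t"
| "fv (Rel r ts) = (\<Union>t \<in> set ts. fv_tm t)"
| "fv (Neg \<phi>) = fv \<phi>"
| "fv (Conj \<phi> \<psi>) = fv \<phi> \<union> fv \<psi>"
| "fv (Exists x \<phi>) = fv \<phi> - {x}"

fun tm_of :: "('f, 'r) lang \<Rightarrow> 'f tm \<Rightarrow> bool" where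
  "tm_of L (Var i) \<longleftrightarrow> True"
| "tm_of L (Fn f ts) \<longleftrightarrow> f \<in> funs L \<and> length ts = farity L f \<and> (\<forall>t \<in> set ts. tm_of L t)"

primrec fm_of :: "('f, 'r) lang \<Rightarrow> ('f, 'r) fm \<Rightarrow> bool" where
  "fm_of L (Eq s t) \<longleftrightarrow> tm_of L s \<and> tm_of L t"
| "fm_of L (Rel r ts) \<longleftrightarrow> r \<in> rels L \<and> length ts = rarity L r \<and> (\<forall>t \<in> set ts. tm_of L t)"
| "fm_of L (Neg \<phi>) \<longleftrightarrow> fm_of L \<phi>"
| "fm_of L (Conj \<phi> \<psi>) \<longleftrightarrow> fm_of L \<phi> \<and> fm_of L \<psi>"
| "fm_of L (Exists x \<phi>) \<longleftrightarrow> fm_of L \<phi>"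

definition sentence_of :: "('f, 'r) lang \<Rightarrow> ('f, 'r) fm \<Rightarrow> bool" where
  "sentence_of L \<sigma> \<longleftrightarrow> fm_of L \<sigma> \<and> fv \<sigma> = {}"

record ('a, 'f, 'r) struct =
  universe :: "'a set"
  fn :: "'f \<Rightarrow> 'a list \<Rightarrow> 'a"
  rel :: "'r \<Rightarrow> 'a list \<Rightarrow> bool"

definition structure_of :: "('f, 'r) lang \<Rightarrow> ('a, 'f, 'r) struct \<Rightarrow> bool" where
  "structure_of L M \<longleftrightarrow> universe M \<noteq> {} \<and>
     (\<forall>f \<in> funs L. \<forall>xs \<in> lists (universe M). length xs = farity L f \<longrightarrow> fn M f xs \<in> universe M)"

primrec eval :: "('a, 'f, 'r) struct \<Rightarrow> (nat \<Rightarrow> 'a) \<Rightarrow> 'f tm \<Rightarrow> 'a" where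
  "eval M v (Var i) = v i"
| "eval M v (Fn f ts) = fn M f (map (eval M v) ts)"

primrec sat :: "('a, 'f, 'r) struct \<Rightarrow> (nat \<Rightarrow> 'a) \<Rightarrow> ('f, 'r) fm \<Rightarrow> bool" where
  "sat M v (Eq s t) \<longleftrightarrow> eval M v s = eval M v t"
| "sat M v (Rel r ts) \<longleftrightarrow> rel M r (map (eval M v) ts)"
| "sat M v (Neg \<phi>) \<longleftrightarrow> \<not> sat M v \<phi>"
| "sat M v (Conj \<phi> \<psi>) \<longleftrightarrow> sat M v \<phi> \<and> sat M v \<psi>"
| "sat M v (Exists x \<phi>) \<longleftrightarrow> (\<exists>a \<in> universe M. sat M (v(x := a)) \<phi>)"

definition substructure ::
  "('f, 'r) lang \<Rightarrow> ('a, 'f, 'r) struct \<Rightarrow> ('a, 'f, 'r) struct \<Rightarrow> bool" where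
  "substructure L N M \<longleftrightarrow> structure_of L N \<and> structure_of L M \<and> universe N \<subseteq> universe M \<and>
     (\<forall>f \<in> funs L. \<forall>xs \<in> lists (universe N). length xs = farity L f \<longrightarrow> fn N f xs = fn M f xs) \<and>
     (\<forall>r \<in> rels L. \<forall>xs \<in> lists (universe N). length xs = rarity L r \<longrightarrow> rel N r xs = rel M r xs)"

definition elem_substructure ::
  "('f, 'r) lang \<Rightarrow> ('a, 'f, 'r) struct \<Rightarrow> ('a, 'f, 'r) struct \<Rightarrow> bool" where
  "elem_substructure L N M \<longleftrightarrow> substructure L N M \<and>
     (\<forall>\<phi> v. fm_of L \<phi> \<longrightarrow> range v \<subseteq> universe N \<longrightarrow> sat N v \<phi> = sat M v \<phi>)"

section \<open>Theories\<close>

definition theory_of :: "('f, 'r) lang \<Rightarrow> ('f, 'r) fm set \<Rightarrow> bool" where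
  "theory_of L T \<longleftrightarrow> (\<forall>\<sigma> \<in> T. sentence_of L \<sigma>)"

definition models :: "('f, 'r) lang \<Rightarrow> ('a, 'f, 'r) struct \<Rightarrow> ('f, 'r) fm set \<Rightarrow> bool" where
  "models L M T \<longleftrightarrow> structure_of L M \<and> (\<forall>\<sigma> \<in> T. \<forall>v. range v \<subseteq> universe M \<longrightarrow> sat M v \<sigma>)"

text \<open>
  HOL cannot quantify over structures of all types inside a formula, so consequence and
  satisfiability range over structures with universe included in the type \<open>nat\<close>. For countable
  languages, the only ones considered here, this is the unrestricted notion by the downward
  Loewenheim-Skolem theorem; the lemmas \<open>entails_all_structures\<close> and
  \<open>satisfiable_of_model\<close> below prove this. A formula with free variables is a consequence of
  \<open>T\<close> iff its universal closure is.
\<close>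

definition entails :: "('f, 'r) lang \<Rightarrow> ('f, 'r) fm set \<Rightarrow> ('f, 'r) fm \<Rightarrow> bool" where
  "entails L T \<phi> \<longleftrightarrow>
     (\<forall>(M :: (nat, 'f, 'r) struct) v. models L M T \<longrightarrow> range v \<subseteq> universe M \<longrightarrow> sat M v \<phi>)"

definition satisfiable :: "('f, 'r) lang \<Rightarrow> ('f, 'r) fm set \<Rightarrow> bool" where
  "satisfiable L T \<longleftrightarrow> (\<exists>M :: (nat, 'f, 'r) struct. models L M T)"

definition complete_theory :: "('f, 'r) lang \<Rightarrow> ('f, 'r) fm set \<Rightarrow> bool" where
  "complete_theory L T \<longleftrightarrow> theory_of L T \<and> satisfiable L T \<and>
     (\<forall>\<sigma>. sentence_of L \<sigma> \<longrightarrow> entails L T \<sigma> \<or> entails L T (Neg \<sigma>))"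

section \<open>Atomic and pseudominimal models\<close>

text \<open>
  The formula \<open>\<phi>(x\<^sub>0,\<dots>,x\<^sub>n\<^sub>-\<^sub>1)\<close> is consistent with \<open>T\<close> and isolates a complete \<open>n\<close>-type of \<open>T\<close>.
\<close>

definition complete_fm :: "('f, 'r) lang \<Rightarrow> ('f, 'r) fm set \<Rightarrow> nat \<Rightarrow> ('f, 'r) fm \<Rightarrow> bool" where
  "complete_fm L T n \<phi> \<longleftrightarrow> fm_of L \<phi> \<and> fv \<phi> \<subseteq> {..<n} \<and> \<not> entails L T (Neg \<phi>) \<and>
     (\<forall>\<psi>. fm_of L \<psi> \<longrightarrow> fv \<psi> \<subseteq> {..<n} \<longrightarrow>
        entails L T (Imp \<phi> \<psi>) \<or> entails L T (Imp \<phi> (Neg \<psi>)))"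

text \<open>
  The tuple \<open>xs\<close> is used as the assignment \<open>nth xs\<close>; its unspecified values from \<open>length xs\<close> on
  do not matter, since the free variables of \<open>\<phi>\<close> are below \<open>length xs\<close>.
\<close>

definition atomic_model ::
  "('f, 'r) lang \<Rightarrow> ('f, 'r) fm set \<Rightarrow> ('a, 'f, 'r) struct \<Rightarrow> bool" where
  "atomic_model L T M \<longleftrightarrow> models L M T \<and>
     (\<forall>xs \<in> lists (universe M). \<exists>\<phi>. complete_fm L T (length xs) \<phi> \<and> sat M (nth xs) \<phi>)"

definition pcl :: "('f, 'r) lang \<Rightarrow> ('a, 'f, 'r) struct \<Rightarrow> 'a set \<Rightarrow> 'a set" where
  "pcl L M B = {a \<in> universe M. \<forall>N. elem_substructure L N M \<longrightarrow> B \<subseteq> universe N \<longrightarrow> a \<in> universe N}"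

definition pseudominimal :: "('f, 'r) lang \<Rightarrow> ('a, 'f, 'r) struct \<Rightarrow> bool" where
  "pseudominimal L M \<longleftrightarrow>
     (\<forall>C a b. finite C \<longrightarrow> C \<subseteq> universe M \<longrightarrow> a \<in> universe M \<longrightarrow> b \<in> universe M \<longrightarrow>
        b \<in> pcl L M (insert a C) \<longrightarrow> b \<notin> pcl L M C \<longrightarrow> a \<in> pcl L M (insert b C))"

section \<open>Adequacy of consequence over countable structures\<close>

instance tm :: (countable) countable
  by countable_datatype

instance fm :: (countable, countable) countable
  by countable_datatype

lemma funs_tm_of: "tm_of L t \<Longrightarrow> funs_tm t \<subseteq> funs L"
  by (induction t) auto

lemma symbols_fm_of: "fm_of L \<phi> \<Longrightarrow> funs_fm \<phi> \<subseteq> funs L \<and> rels_fm \<phi> \<subseteq> rels L"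
  by (induction \<phi>) (fastforce dest: funs_tm_of)+

lemma countable_fm_of:
  assumes "countable_lang L"
  shows "countable {\<phi>. fm_of L \<phi>}"
proof -
  let ?f = "to_nat_on (funs L)" and ?r = "to_nat_on (rels L)"
  have inj: "inj_on ?f (funs L)" "inj_on ?r (rels L)"
    using assms by (auto simp: countable_lang_def)
  have "inj_on (map_fm ?f ?r) {\<phi>. fm_of L \<phi>}"
  proof (rule inj_onI)
    fix \<phi> \<psi> assume "\<phi> \<in> {\<phi>. fm_of L \<phi>}" "\<psi> \<in> {\<phi>. fm_of L \<phi>}"
      and eq: "map_fm ?f ?r \<phi> = map_fm ?f ?r \<psi>"
    then have s: "funs_fm \<phi> \<subseteq> funs L" "rels_fm \<phi> \<subseteq> rels L" "funs_fm \<psi> \<subseteq> funs L" "rels_fm \<psi> \<subseteq> rels L"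
      using symbols_fm_of by blast+
    show "\<phi> = \<psi>"
      by (rule fm.inj_map_strong[OF _ _ eq]) (use s inj in \<open>auto dest: inj_onD\<close>)
  qed
  then show ?thesis
    by (metis countableI_type countable_image_inj_on countable_subset subset_UNIV countable_image_inj_eq)
qed

lemma eval_cong: "(\<And>i. i \<in> fv_tm t \<Longrightarrow> v i = w i) \<Longrightarrow> eval M v t = eval M w t"
proof (induction t)
  case (Fn f ts)
  have "map (eval M v) ts = map (eval M w) ts"
    by (rule map_cong[OF refl], rule Fn.IH) (use Fn.prems in auto)
  then show ?case by (metis eval.simps(2))
qed auto

lemma sat_cong: "(\<And>i. i \<in> fv \<phi> \<Longrightarrow> v i = w i) \<Longrightarrow> sat M v \<phi> = sat M w \<phi>"
proof (induction \<phi> arbitrary: v w)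
  case (Eq s t)
  then show ?case using eval_cong[of s v w M] eval_cong[of t v w M] by auto
next
  case (Rel r ts)
  have "map (eval M v) ts = map (eval M w) ts"
    by (rule map_cong[OF refl], rule eval_cong) (use Rel in auto)
  then show ?case by (metis sat.simps(2))
next
  case (Neg \<phi>)
  then show ?case by (metis fv.simps(3) sat.simps(3))
next
  case (Conj \<phi> \<psi>)
  then show ?case by (metis UnCI fv.simps(4) sat.simps(4))
next
  case (Exists x \<phi>)
  have "sat M (v(x := a)) \<phi> = sat M (w(x := a)) \<phi>" for a
    by (rule Exists.IH) (use Exists.prems in auto)
  then show ?case by simp
qed

lemma finite_fv_tm: "finite (fv_tm t)"
  by (induction t) auto

lemma finite_fv: "finite (fv \<phi>)"
  by (induction \<phi>) (auto simp: finite_fv_tm)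

lemma eval_in_univ:
  assumes "structure_of L M" "range v \<subseteq> universe M" "tm_of L t"
  shows "eval M v t \<in> universe M"
  using assms(3)
proof (induction t)
  case (Var i)
  then show ?case using assms(2) by auto
next
  case (Fn f ts)
  then have "map (eval M v) ts \<in> lists (universe M)" by auto
  then show ?case using Fn.prems assms(1) by (auto simp: structure_of_def)
qed

lemma downward_LS:
  fixes M :: "('a, 'f, 'r) struct"
  assumes L: "countable_lang L" and M: "structure_of L M"
    and A: "A \<subseteq> universe M" "countable A" "A \<noteq> {}"
  obtains N where "elem_substructure L N M" "A \<subseteq> universe N" "countable (universe N)"
proof -
  define wit where "wit \<phi> x xs = (SOME a. a \<in> universe M \<and> sat M ((nth xs)(x := a)) \<phi>)"
    for \<phi> :: "('f, 'r) fm" and x and xs :: "'a list"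
  define G where "G S = S
      \<union> (\<lambda>(f, xs). fn M f xs) ` {(f, xs). f \<in> funs L \<and> xs \<in> lists S \<and> length xs = farity L f}
      \<union> ((\<lambda>(\<phi>, x, xs). wit \<phi> x xs) ` ({\<phi>. fm_of L \<phi>} \<times> UNIV \<times> lists S) \<inter> universe M)" for S
  define H where "H = (\<Union>n. (G ^^ n) A)"
  have sub: "(G ^^ n) A \<subseteq> universe M" for n
  proof (induction n)
    case (Suc n)
    have "fn M f xs \<in> universe M"
      if "f \<in> funs L" "\<forall>x \<in> set xs. x \<in> (G ^^ n) A" "length xs = farity L f" for f xs
      using that Suc M unfolding structure_of_def by (meson in_listsI subsetD)
    then show ?case using Suc unfolding funpow.simps o_apply
      by (subst G_def) auto
  qed (use A in auto)
  have cnt: "countable ((G ^^ n) A)" for n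
  proof (induction n)
    case (Suc n)
    have "countable {(f, xs). f \<in> funs L \<and> xs \<in> lists ((G ^^ n) A) \<and> length xs = farity L f}"
      by (rule countable_subset[of _ "funs L \<times> lists ((G ^^ n) A)"])
         (use Suc L in \<open>auto simp: countable_lang_def\<close>)
    moreover have "countable ({\<phi>. fm_of L \<phi>} \<times> (UNIV :: nat set) \<times> lists ((G ^^ n) A))"
      using Suc countable_fm_of[OF L] by blast
    ultimately show ?case using Suc unfolding funpow.simps o_apply
      by (subst G_def) (intro countable_Un countable_image countable_Int1)
  qed (use A in auto)
  have step: "(G ^^ n) A \<subseteq> (G ^^ Suc n) A" for n
    unfolding funpow.simps o_apply by (subst G_def) auto
  have mono: "m \<le> n \<Longrightarrow> (G ^^ m) A \<subseteq> (G ^^ n) A" for m n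
    by (rule lift_Suc_mono_le[of "\<lambda>n. (G ^^ n) A"]) (use step in auto)
  have stage: "\<exists>n. xs \<in> lists ((G ^^ n) A)" if "xs \<in> lists H" for xs
    using that
  proof (induction xs)
    case (Cons x xs)
    then obtain m where m: "xs \<in> lists ((G ^^ m) A)" by auto
    from Cons obtain n where n: "x \<in> (G ^^ n) A" by (auto simp: H_def)
    have "x \<in> (G ^^ max m n) A" "xs \<in> lists ((G ^^ max m n) A)"
      using m n mono[of m "max m n"] mono[of n "max m n"] by auto
    then show ?case by (metis Cons_in_lists_iff)
  qed auto
  have HM: "H \<subseteq> universe M" using sub by (auto simp: H_def)
  have AH: "A \<subseteq> H" unfolding H_def using UN_upper[of 0 UNIV "\<lambda>n. (G ^^ n) A"] by simp
  have Hfn: "fn M f xs \<in> H" if *: "f \<in> funs L" "xs \<in> lists H" "length xs = farity L f" for f xs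
  proof -
    obtain n where "xs \<in> lists ((G ^^ n) A)" using stage[of xs] * by blast
    then have "fn M f xs \<in> (G ^^ Suc n) A"
      using that unfolding funpow.simps o_apply by (subst G_def) (rule UnI1, rule UnI2, rule image_eqI[of _ _ "(f, xs)"], auto)
    then show ?thesis unfolding H_def by blast
  qed
  have Hwit: "wit \<phi> x xs \<in> H" if *: "fm_of L \<phi>" "xs \<in> lists H" "wit \<phi> x xs \<in> universe M" for \<phi> x xs
  proof -
    obtain n where "xs \<in> lists ((G ^^ n) A)" using stage[of xs] * by blast
    then have "wit \<phi> x xs \<in> (G ^^ Suc n) A"
      using that unfolding funpow.simps o_apply by (subst G_def) (rule UnI2, rule IntI, rule image_eqI[of _ _ "(\<phi>, x, xs)"], auto)
    then show ?thesis unfolding H_def by blast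
  qed
  define N where "N = M\<lparr>universe := H\<rparr>"
  have N: "universe N = H" "fn N = fn M" "rel N = rel M" by (auto simp: N_def)
  have sN: "structure_of L N"
    using A AH Hfn by (auto simp: structure_of_def N)
  have ev: "eval N v t = eval M v t" for v t
    by (induction t) (auto simp: N cong: map_cong)
  have ev': "eval N v = eval M v" for v using ev by blast
  have "sat N v \<phi> = sat M v \<phi>" if "fm_of L \<phi>" "range v \<subseteq> H" for \<phi> v
    using that
  proof (induction \<phi> arbitrary: v)
    case (Exists x \<phi>)
    have IH: "sat N (v(x := a)) \<phi> = sat M (v(x := a)) \<phi>" if "a \<in> H" for a
      by (rule Exists.IH) (use Exists.prems that in auto)
    have "\<exists>a \<in> H. sat M (v(x := a)) \<phi>" if b: "b \<in> universe M" "sat M (v(x := b)) \<phi>" for b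
    proof -
      obtain n where n: "fv \<phi> \<subseteq> {..<n}"
        using finite_fv finite_nat_iff_bounded by blast
      define xs where "xs = map v [0..<n]"
      have same: "sat M ((nth xs)(x := a)) \<phi> = sat M (v(x := a)) \<phi>" for a
        by (rule sat_cong) (use n in \<open>auto simp: xs_def\<close>)
      have w: "wit \<phi> x xs \<in> universe M \<and> sat M ((nth xs)(x := wit \<phi> x xs)) \<phi>"
        unfolding wit_def by (rule someI[of _ b]) (use b same in auto)
      moreover have "wit \<phi> x xs \<in> H"
        by (rule Hwit) (use Exists.prems w in \<open>auto simp: xs_def image_subset_iff\<close>)
      ultimately show ?thesis using same by blast
    qed
    then show ?case using IH HM by (auto simp: N)
  qed (auto simp: N ev')
  then have "elem_substructure L N M"
    using sN M HM by (auto simp: elem_substructure_def substructure_def N)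
  moreover have "countable (universe N)" using cnt by (simp add: N H_def)
  ultimately show thesis using that AH N by blast
qed

lemma isomorphic_copy:
  fixes N :: "('a, 'f, 'r) struct" and h :: "'a \<Rightarrow> 'b"
  assumes N: "structure_of L N" and h: "inj_on h (universe N)"
  obtains N' :: "('b, 'f, 'r) struct" where "structure_of L N'" "universe N' = h ` universe N"
    "\<And>\<phi> v. fm_of L \<phi> \<Longrightarrow> range v \<subseteq> universe N \<Longrightarrow> sat N' (h \<circ> v) \<phi> = sat N v \<phi>"
proof -
  define g where "g = inv_into (universe N) h"
  define N' :: "('b, 'f, 'r) struct" where
    "N' = \<lparr>universe = h ` universe N, fn = (\<lambda>f xs. h (fn N f (map g xs))), rel = (\<lambda>r xs. rel N r (map g xs))\<rparr>"
  have gh: "g (h a) = a" if "a \<in> universe N" for a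
    using h that by (simp add: g_def)
  have maps: "map g (map h xs) = xs" if "set xs \<subseteq> universe N" for xs
    using that gh by (induction xs) auto
  have sN': "structure_of L N'"
  proof -
    have "map g xs \<in> lists (universe N)" if "xs \<in> lists (h ` universe N)" for xs
      using that gh by (induction xs) auto
    then show ?thesis using N by (auto simp: structure_of_def N'_def)
  qed
  have ev: "eval N' (h \<circ> v) t = h (eval N v t)" if "tm_of L t" "range v \<subseteq> universe N" for t v
    using that(1)
  proof (induction t)
    case (Fn f ts)
    have "map (eval N' (h \<circ> v)) ts = map h (map (eval N v) ts)"
      unfolding map_map by (rule map_cong[OF refl]) (use Fn in \<open>simp add: comp_def\<close>)
    moreover have "set (map (eval N v) ts) \<subseteq> universe N"
      using Fn.prems eval_in_univ[OF N that(2)] by auto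
    moreover have "fn N' f xs = h (fn N f (map g xs))" for xs
      by (simp add: N'_def)
    ultimately show ?case using maps by (simp only: eval.simps)
  qed auto
  have "sat N' (h \<circ> v) \<phi> = sat N v \<phi>" if "fm_of L \<phi>" "range v \<subseteq> universe N" for \<phi> v
    using that
  proof (induction \<phi> arbitrary: v)
    case (Eq s t)
    then show ?case
      using eval_in_univ[OF N] by (simp only: sat.simps fm_of.simps ev inj_on_eq_iff[OF h])
  next
    case (Rel r ts)
    have "map (eval N' (h \<circ> v)) ts = map h (map (eval N v) ts)"
      using Rel ev by auto
    moreover have "set (map (eval N v) ts) \<subseteq> universe N"
      using Rel.prems eval_in_univ[OF N Rel.prems(2)] by auto
    moreover have "rel N' r xs = rel N r (map g xs)" for xs
      by (simp add: N'_def)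
    ultimately show ?case using maps by (simp only: sat.simps)
  next
    case (Exists x \<phi>)
    have "sat N' ((h \<circ> v)(x := h a)) \<phi> = sat N (v(x := a)) \<phi>" if "a \<in> universe N" for a
    proof -
      have "(h \<circ> v)(x := h a) = h \<circ> v(x := a)" by (rule ext) simp
      moreover have "range (v(x := a)) \<subseteq> universe N" using Exists.prems that by auto
      ultimately show ?thesis using Exists.IH[of "v(x := a)"] Exists.prems by (simp only: fm_of.simps)
    qed
    moreover have "universe N' = h ` universe N" by (simp add: N'_def)
    ultimately show ?case by (simp only: sat.simps bex_simps(7) cong: bex_cong)
  qed auto
  moreover have "universe N' = h ` universe N" by (simp add: N'_def)
  ultimately show thesis using that[OF sN'] by blast
qed

lemma countable_model:
  fixes M :: "('a, 'f, 'r) struct"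
  assumes "countable_lang L" "theory_of L T" "models L M T" "range v \<subseteq> universe M"
  obtains N :: "(nat, 'f, 'r) struct" and w where "models L N T" "range w \<subseteq> universe N"
    "\<And>\<phi>. fm_of L \<phi> \<Longrightarrow> sat N w \<phi> = sat M v \<phi>"
proof -
  have M: "structure_of L M" using assms by (simp add: models_def)
  obtain K where K: "elem_substructure L K M" "range v \<subseteq> universe K" "countable (universe K)"
    by (rule downward_LS[OF assms(1) M assms(4)]) auto
  then have sK: "structure_of L K"
    and KM: "\<And>\<phi> u. fm_of L \<phi> \<Longrightarrow> range u \<subseteq> universe K \<Longrightarrow> sat K u \<phi> = sat M u \<phi>" "universe K \<subseteq> universe M"
    by (auto simp: elem_substructure_def substructure_def)
  define h where "h = to_nat_on (universe K)"
  have "inj_on h (universe K)" unfolding h_def by (rule inj_on_to_nat_on) (rule K(3))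
  then obtain N :: "(nat, 'f, 'r) struct" where N: "structure_of L N" "universe N = h ` universe K"
    "\<And>\<phi> u. fm_of L \<phi> \<Longrightarrow> range u \<subseteq> universe K \<Longrightarrow> sat N (h \<circ> u) \<phi> = sat K u \<phi>"
    using isomorphic_copy[OF sK] by metis
  have "sat N u \<sigma>" if "\<sigma> \<in> T" for u \<sigma>
  proof -
    have \<sigma>: "fm_of L \<sigma>" "fv \<sigma> = {}" using that assms by (auto simp: theory_of_def sentence_of_def)
    have "sat N u \<sigma> = sat N (h \<circ> v) \<sigma>" by (rule sat_cong) (use \<sigma> in auto)
    also have "\<dots> = sat M v \<sigma>" using N(3)[OF \<sigma>(1) K(2)] KM(1)[OF \<sigma>(1) K(2)] by simp
    finally show ?thesis using assms that by (auto simp: models_def)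
  qed
  then have "models L N T" using N by (auto simp: models_def)
  moreover have "range (h \<circ> v) \<subseteq> universe N" using K N by auto
  ultimately show thesis using that[of N "h \<circ> v"] N(3) K(2) KM(1) by blast
qed

lemma entails_all_structures:
  fixes M :: "('a, 'f, 'r) struct"
  assumes "countable_lang L" "theory_of L T" "fm_of L \<phi>" "entails L T \<phi>"
    and "models L M T" "range v \<subseteq> universe M"
  shows "sat M v \<phi>"
  using countable_model[OF assms(1,2,5,6)] assms(3,4) unfolding entails_def by metis

lemma satisfiable_of_model:
  fixes M :: "('a, 'f, 'r) struct"
  assumes "countable_lang L" "theory_of L T" "models L M T"
  shows "satisfiable L T"
proof -
  obtain a where "a \<in> universe M" using assms(3) by (auto simp: models_def structure_of_def)
  then have "range (\<lambda>_. a) \<subseteq> universe M" by auto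
  from countable_model[OF assms this] show ?thesis unfolding satisfiable_def by metis
qed

end

theory Submission
  imports Defs "HOL-Library.FuncSet"
begin

text \<open>
  Countable atomic models of a complete theory are isomorphic, so whether \<open>a \<in> pcl(C)\<close> holds
  depends only on the type of \<open>(a, C)\<close>; hence every atomic model of \<open>T\<close> is pseudominimal as soon as
  one is, and it suffices to find an atomic model of size continuum. Uncountability of \<open>M\<close> yields a
  countable atomic model \<open>K\<close> with an element outside \<open>pcl({})\<close>. All further work takes place in \<open>K\<close>.

  Finite approximations in \<open>K\<close> are built in \<open>\<omega>\<close> steps. Step \<open>n\<close> has the nodes \<open>0, \<dots>, 2^n - 1\<close>, and
  every element of the approximation is labelled by the set of nodes it depends on. The
  node \<open>x\<close> is split into \<open>x\<close> and \<open>x + 2^n\<close> by a copy, of the same type over the elements not involving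
  \<open>x\<close>, of all elements involving \<open>x\<close>. Exchange allows the copy to be chosen independent over everything
  present, which keeps the dependence structure. Between splittings, Henkin
  witnesses for one formula and all tuples of the approximation are added. A finite set of branches through the binary
  tree then determines sequences in \<open>K\<close> whose joint type is eventually constant, and these sequences,
  modulo eventual equality, form the required model.
\<close>

section \<open>Partial elementary relations\<close>

text \<open>Hence types are only ever realised inside a countable atomic model: a tuple of the limit
  has, from some stage on, the type of a tuple of that model, and this type is isolated. The
  difficulty lies in splitting a node \<open>x\<close>. Everything not involving \<open>x\<close>
  must stay fixed, so the base elements involving \<open>x\<close> have to be independent over all
  of it, including the Henkin witnesses, which are not independent themselves. The labels are kept
  for this purpose: an element lies in the closure of the base elements whose labels are contained
  in its own, so the elements without \<open>x\<close> lie in the closure of the base elements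
  without \<open>x\<close>. Exchange is what lets an independent set grow; dependent elements are
  then carried along by extending an elementary map. A witness may depend on every node present, so
  it is labelled by all of them; later splittings copy it to every choice of one successor for each
  node. Statements about sequences hold only eventually, because branches share nodes until they
  separate and because names enter late.\<close>

lemma finite_subset_UN_mono:
  fixes S :: "nat \<Rightarrow> 'a set"
  assumes "finite A" "\<And>i j. i \<le> j \<Longrightarrow> S i \<subseteq> S j" "A \<subseteq> (\<Union>k. S k)"
  obtains k where "A \<subseteq> S k"
proof -
  from assms(1,3) have "\<exists>k. A \<subseteq> S k"
  proof (induction A)
    case (insert a A)
    then obtain k l where "A \<subseteq> S k" "a \<in> S l" by auto
    then have "insert a A \<subseteq> S (max k l)" using assms(2)[of k "max k l"] assms(2)[of l "max k l"] by auto
    then show ?case ..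
  qed auto
  then show thesis using that by blast
qed

section \<open>Renaming of variables, to fit a formula to a given tuple\<close>

primrec rename_tm :: "(nat \<Rightarrow> nat) \<Rightarrow> 'f tm \<Rightarrow> 'f tm" where
  "rename_tm g (Var i) = Var (g i)"
| "rename_tm g (Fn f ts) = Fn f (map (rename_tm g) ts)"

text \<open>The formula is the first argument because the renaming changes under a quantifier. The
  bound variable moves outside the image of the free variables, so that a non-injective
  \<open>g\<close> captures nothing; such \<open>g\<close> may arise when two variables take the
  same value.\<close>

primrec rename :: "('f, 'r) fm \<Rightarrow> (nat \<Rightarrow> nat) \<Rightarrow> ('f, 'r) fm" where
  "rename (Eq s t) g = Eq (rename_tm g s) (rename_tm g t)"
| "rename (Rel r ts) g = Rel r (map (rename_tm g) ts)"
| "rename (Neg \<phi>) g = Neg (rename \<phi> g)"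
| "rename (Conj \<phi> \<psi>) g = Conj (rename \<phi> g) (rename \<psi> g)"
| "rename (Exists x \<phi>) g =
     Exists (SOME y. y \<notin> g ` fv \<phi>) (rename \<phi> (g(x := SOME y. y \<notin> g ` fv \<phi>)))"

lemma rename_fresh: "(SOME y :: nat. y \<notin> g ` fv \<phi>) \<notin> g ` fv \<phi>"
  by (rule someI_ex) (rule ex_new_if_finite[OF infinite_UNIV_nat finite_imageI[OF finite_fv]])

lemma eval_rename: "eval M v (rename_tm g t) = eval M (v \<circ> g) t"
  by (induction t) (auto simp: comp_def cong: map_cong)

lemma fv_rename_tm: "fv_tm (rename_tm g t) = g ` fv_tm t"
  by (induction t) auto

lemma tm_of_rename: "tm_of L (rename_tm g t) = tm_of L t"
  by (induction t) auto

lemma fm_of_rename: "fm_of L (rename \<phi> g) = fm_of L \<phi>"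
  by (induction \<phi> arbitrary: g) (auto simp: tm_of_rename)

lemma fv_rename: "fv (rename \<phi> g) \<subseteq> g ` fv \<phi>"
proof (induction \<phi> arbitrary: g)
  case (Exists x \<phi>)
  define y where "y = (SOME y. y \<notin> g ` fv \<phi>)"
  have "fv (rename \<phi> (g(x := y))) \<subseteq> (g(x := y)) ` fv \<phi>" by (rule Exists)
  then show ?case by (auto simp flip: y_def)
next
  case (Conj \<phi> \<psi>)
  then show ?case by simp blast
qed (auto simp: fv_rename_tm)

lemma sat_rename: "sat M v (rename \<phi> g) = sat M (v \<circ> g) \<phi>"
proof (induction \<phi> arbitrary: g v)
  case (Rel r ts)
  have "map (eval M v) (map (rename_tm g) ts) = map (eval M (v \<circ> g)) ts"
    by (simp add: eval_rename)
  then show ?case by (simp only: rename.simps sat.simps)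
next
  case (Exists x \<phi>)
  define y where "y = (SOME y. y \<notin> g ` fv \<phi>)"
  have y: "y \<notin> g ` fv \<phi>" unfolding y_def by (rule rename_fresh)
  have "sat M (v(y := a)) (rename \<phi> (g(x := y))) = sat M ((v \<circ> g)(x := a)) \<phi>" for a
    unfolding Exists by (rule sat_cong) (use y in auto)
  then show ?case by (simp add: comp_def flip: y_def)
qed (auto simp: eval_rename)

text \<open>A relation instead of a partial function, so that converses, composites and finite
  extensions come without side conditions; the equality formula makes it the graph of an injection
  (\<open>pelem_inj\<close>). Constraining \<open>v\<close> on the free variables only lets the
  empty relation speak about sentences.\<close>

definition pelem :: "('f, 'r) lang \<Rightarrow> ('a, 'f, 'r) struct \<Rightarrow> ('b, 'f, 'r) struct \<Rightarrow> ('a \<times> 'b) set \<Rightarrow> bool"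
  where "pelem L M N R \<longleftrightarrow> R \<subseteq> universe M \<times> universe N \<and>
    (\<forall>\<phi> v. fm_of L \<phi> \<longrightarrow> v ` fv \<phi> \<subseteq> R \<longrightarrow> sat M (fst \<circ> v) \<phi> = sat N (snd \<circ> v) \<phi>)"

lemma pelem_sat:
  assumes "pelem L M N R" "fm_of L \<phi>" "\<And>i. i \<in> fv \<phi> \<Longrightarrow> (u i, w i) \<in> R"
  shows "sat M u \<phi> = sat N w \<phi>"
proof -
  have "(\<lambda>i. (u i, w i)) ` fv \<phi> \<subseteq> R" using assms(3) by (rule image_subsetI)
  then have "sat M (fst \<circ> (\<lambda>i. (u i, w i))) \<phi> = sat N (snd \<circ> (\<lambda>i. (u i, w i))) \<phi>"
    using assms(1,2) unfolding pelem_def by (elim conjE allE impE)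
  then show ?thesis by (simp add: comp_def)
qed

lemma pelemI:
  assumes "R \<subseteq> universe M \<times> universe N"
    and "\<And>\<phi> v. fm_of L \<phi> \<Longrightarrow> v ` fv \<phi> \<subseteq> R \<Longrightarrow> sat M (fst \<circ> v) \<phi> = sat N (snd \<circ> v) \<phi>"
  shows "pelem L M N R"
  unfolding pelem_def by (intro conjI allI impI assms)

lemma pelem_mono: "pelem L M N R \<Longrightarrow> R' \<subseteq> R \<Longrightarrow> pelem L M N R'"
  unfolding pelem_def by blast

lemma pelem_converse:
  fixes M :: "('a, 'f, 'r) struct" and N :: "('b, 'f, 'r) struct"
  assumes "pelem L M N R" shows "pelem L N M (R\<inverse>)"
proof (rule pelemI)
  fix \<phi> and v :: "nat \<Rightarrow> 'b \<times> 'a" assume "fm_of L \<phi>" "v ` fv \<phi> \<subseteq> R\<inverse>"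
  then show "sat N (fst \<circ> v) \<phi> = sat M (snd \<circ> v) \<phi>"
    using pelem_sat[OF assms, of \<phi> "snd \<circ> v" "fst \<circ> v"] by (force simp: image_subset_iff)
qed (use assms in \<open>auto simp: pelem_def\<close>)

lemma pelem_relcomp:
  fixes M :: "('a, 'f, 'r) struct" and N :: "('b, 'f, 'r) struct" and K :: "('c, 'f, 'r) struct"
  assumes "pelem L M N R" "pelem L N K S" shows "pelem L M K (R O S)"
proof (rule pelemI)
  fix \<phi> and v :: "nat \<Rightarrow> 'a \<times> 'c" assume \<phi>: "fm_of L \<phi>" "v ` fv \<phi> \<subseteq> R O S"
  then have "\<forall>i. \<exists>b. i \<in> fv \<phi> \<longrightarrow> (fst (v i), b) \<in> R \<and> (b, snd (v i)) \<in> S"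
    by (fastforce simp: image_subset_iff)
  then obtain w where "\<And>i. i \<in> fv \<phi> \<Longrightarrow> (fst (v i), w i) \<in> R \<and> (w i, snd (v i)) \<in> S"
    by metis
  then show "sat M (fst \<circ> v) \<phi> = sat K (snd \<circ> v) \<phi>"
    using pelem_sat[OF assms(1) \<phi>(1), of "fst \<circ> v" w] pelem_sat[OF assms(2) \<phi>(1), of w "snd \<circ> v"]
    by simp
qed (use assms in \<open>auto simp: pelem_def\<close>)

lemma pelem_Id_on:
  fixes M :: "('a, 'f, 'r) struct"
  shows "A \<subseteq> universe M \<Longrightarrow> pelem L M M (Id_on A)"
proof (rule pelemI)
  fix \<phi> :: "('f, 'r) fm" and v :: "nat \<Rightarrow> 'a \<times> 'a" assume "v ` fv \<phi> \<subseteq> Id_on A"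
  then show "sat M (fst \<circ> v) \<phi> = sat M (snd \<circ> v) \<phi>"
    by (intro sat_cong) (auto simp: Id_on_def image_subset_iff)
qed auto

lemma pelem_inj:
  assumes "pelem L M N R" "(a, b) \<in> R" "(a', b') \<in> R"
  shows "a = a' \<longleftrightarrow> b = b'"
proof -
  have "sat M (\<lambda>i. if i = 0 then a else a') (Eq (Var 0) (Var 1)) =
        sat N (\<lambda>i. if i = 0 then b else b') (Eq (Var 0) (Var 1))"
    by (rule pelem_sat[OF assms(1)]) (use assms in auto)
  then show ?thesis by simp
qed

lemma atomic_model_models: "atomic_model L T M \<Longrightarrow> models L M T"
  by (simp add: atomic_model_def)

section \<open>Extending finite elementary relations that start in an atomic model\<close>

locale complete_countable_theory =
  fixes L :: "('f, 'r) lang" and T :: "('f, 'r) fm set"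
  assumes countable_L: "countable_lang L" and complete_T: "complete_theory L T"
begin

lemma theory_T: "theory_of L T"
  using complete_T by (simp add: complete_theory_def)

lemma entails_sat:
  assumes "entails L T \<phi>" "fm_of L \<phi>" "models L M T" "v ` fv \<phi> \<subseteq> universe M"
  shows "sat M v \<phi>"
proof -
  obtain a where a: "a \<in> universe M" using assms(3) by (auto simp: models_def structure_of_def)
  have "sat M (\<lambda>i. if i \<in> fv \<phi> then v i else a) \<phi>"
    by (rule entails_all_structures[OF countable_L theory_T assms(2,1,3)]) (use a assms in auto)
  then show ?thesis using sat_cong[of \<phi> v "\<lambda>i. if i \<in> fv \<phi> then v i else a" M] by simp
qed

text \<open>Which of \<open>Imp \<phi> \<psi>\<close> and \<open>Imp \<phi> (Neg \<psi>)\<close> is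
  entailed depends on \<open>T\<close> alone, so \<open>\<phi>\<close> forces the same answer in
  both models.\<close>

lemma complete_fm_sat_iff:
  assumes \<phi>: "complete_fm L T n \<phi>" and \<psi>: "fm_of L \<psi>" "fv \<psi> \<subseteq> {..<n}"
    and M: "models L M T" "sat M u \<phi>" "u ` {..<n} \<subseteq> universe M"
    and N: "models L N T" "sat N w \<phi>" "w ` {..<n} \<subseteq> universe N"
  shows "sat M u \<psi> = sat N w \<psi>"
proof -
  have f: "fm_of L (Imp \<phi> \<psi>)" "fm_of L (Imp \<phi> (Neg \<psi>))" "fv (Imp \<phi> \<psi>) \<subseteq> {..<n}" "fv (Imp \<phi> (Neg \<psi>)) \<subseteq> {..<n}"
    using \<phi> \<psi> by (auto simp: complete_fm_def Imp_def)
  have im: "u ` fv \<chi> \<subseteq> universe M" "w ` fv \<chi> \<subseteq> universe N" if "fv \<chi> \<subseteq> {..<n}" for \<chi> :: "('f, 'r) fm"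
    using that M(3) N(3) by blast+
  consider "entails L T (Imp \<phi> \<psi>)" | "entails L T (Imp \<phi> (Neg \<psi>))"
    using \<phi> \<psi> by (auto simp: complete_fm_def)
  then show ?thesis
  proof cases
    case 1
    then have "sat M u (Imp \<phi> \<psi>)" "sat N w (Imp \<phi> \<psi>)"
      by (auto intro!: entails_sat[OF _ _ M(1) im(1)] entails_sat[OF _ _ N(1) im(2)] f simp del: sat.simps)
    then show ?thesis using M N by (simp add: Imp_def)
  next
    case 2
    then have "sat M u (Imp \<phi> (Neg \<psi>))" "sat N w (Imp \<phi> (Neg \<psi>))"
      by (auto intro!: entails_sat[OF _ _ M(1) im(1)] entails_sat[OF _ _ N(1) im(2)] f simp del: sat.simps)
    then show ?thesis using M N by (simp add: Imp_def)
  qed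
qed

lemma pelem_empty:
  fixes M :: "('a, 'f, 'r) struct" and N :: "('b, 'f, 'r) struct"
  assumes "models L M T" "models L N T" shows "pelem L M N {}"
proof (rule pelemI)
  fix \<phi> and v :: "nat \<Rightarrow> 'a \<times> 'b" assume "fm_of L \<phi>" "v ` fv \<phi> \<subseteq> {}"
  then have s: "sentence_of L \<phi>" by (simp add: sentence_of_def)
  then consider "entails L T \<phi>" | "entails L T (Neg \<phi>)"
    using complete_T by (auto simp: complete_theory_def)
  then show "sat M (fst \<circ> v) \<phi> = sat N (snd \<circ> v) \<phi>"
  proof cases
    case 1
    then show ?thesis using s assms by (auto simp: sentence_of_def intro!: entails_sat)
  next
    case 2
    then have "sat M (fst \<circ> v) (Neg \<phi>)" "sat N (snd \<circ> v) (Neg \<phi>)"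
      using s assms by (auto simp: sentence_of_def intro!: entails_sat simp del: sat.simps)
    then show ?thesis by simp
  qed
qed auto

text \<open>Some \<open>\<phi>\<close> isolates the type of the domain of \<open>R\<close> together
  with \<open>a\<close>. Quantifying its last variable gives a formula that \<open>R\<close>
  transports to \<open>N\<close>, and any realisation there has the right type. Atomicity is used on
  the side of \<open>a\<close> only.\<close>

lemma pelem_extend:
  fixes M :: "('a, 'f, 'r) struct" and N :: "('b, 'f, 'r) struct"
  assumes M: "atomic_model L T M" and N: "models L N T"
    and R: "pelem L M N R" "finite R" and a: "a \<in> universe M"
  obtains b where "b \<in> universe N" "pelem L M N (insert (a, b) R)"
proof -
  obtain rs where rs: "set rs = R" using R(2) finite_list by blast
  define n where "n = length rs"
  have RMN: "R \<subseteq> universe M \<times> universe N" using R by (simp add: pelem_def)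
  have "map fst rs @ [a] \<in> lists (universe M)" using RMN a rs by fastforce
  then obtain \<phi> where \<phi>: "complete_fm L T (Suc n) \<phi>" "sat M (nth (map fst rs @ [a])) \<phi>"
    using M unfolding atomic_model_def n_def by (metis length_append_singleton length_map)
  have fv\<phi>: "fv \<phi> \<subseteq> {..<Suc n}" "fm_of L \<phi>" using \<phi> by (auto simp: complete_fm_def)
  have "sat M ((nth (map fst rs))(n := a)) \<phi>"
    using \<phi>(2) by (rule iffD1[OF sat_cong, rotated]) (use fv\<phi> in \<open>auto simp: nth_append n_def\<close>)
  then have "sat M (nth (map fst rs)) (Exists n \<phi>)" using a by auto
  moreover have "sat M (nth (map fst rs)) (Exists n \<phi>) = sat N (nth (map snd rs)) (Exists n \<phi>)"
    by (rule pelem_sat[OF R(1)]) (use fv\<phi> rs in \<open>auto simp: n_def less_Suc_eq\<close>)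
  ultimately obtain b where b: "b \<in> universe N" "sat N ((nth (map snd rs))(n := b)) \<phi>" by auto
  have b': "sat N (nth (map snd rs @ [b])) \<phi>"
    using b(2) by (rule iffD1[OF sat_cong, rotated]) (use fv\<phi> in \<open>auto simp: nth_append n_def\<close>)
  have "pelem L M N (insert (a, b) R)"
  proof (rule pelemI)
    fix \<psi> and v :: "nat \<Rightarrow> 'a \<times> 'b" assume \<psi>: "fm_of L \<psi>" "v ` fv \<psi> \<subseteq> insert (a, b) R"
    let ?rs = "rs @ [(a, b)]"
    \<comment> \<open>\<open>g\<close> sends the variables of \<open>\<psi>\<close> to positions in
      the tuple; the renamed formula is one that \<open>\<phi>\<close> decides.\<close>
    have "\<forall>i. \<exists>k. i \<in> fv \<psi> \<longrightarrow> k < Suc n \<and> ?rs ! k = v i"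
    proof
      fix i
      have "v i \<in> set ?rs" if "i \<in> fv \<psi>" using that \<psi> rs by auto
      then show "\<exists>k. i \<in> fv \<psi> \<longrightarrow> k < Suc n \<and> ?rs ! k = v i"
        unfolding in_set_conv_nth by (auto simp: n_def)
    qed
    then obtain g where g: "\<And>i. i \<in> fv \<psi> \<Longrightarrow> g i < Suc n \<and> ?rs ! g i = v i" by metis
    have nth: "(map fst rs @ [a]) ! k = fst (?rs ! k)" "(map snd rs @ [b]) ! k = snd (?rs ! k)"
      if "k < Suc n" for k
      using that by (auto simp: nth_append n_def)
    have mem: "nth (map fst rs @ [a]) ` {..<Suc n} \<subseteq> universe M" "nth (map snd rs @ [b]) ` {..<Suc n} \<subseteq> universe N"
      using RMN a b rs nth_mem[of _ rs] by (fastforce simp: nth_append n_def)+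
    have "sat M (fst \<circ> v) \<psi> = sat M (nth (map fst rs @ [a])) (rename \<psi> g)"
      unfolding sat_rename by (rule sat_cong) (use g nth in simp)
    also have "\<dots> = sat N (nth (map snd rs @ [b])) (rename \<psi> g)"
      by (rule complete_fm_sat_iff[OF \<phi>(1) _ _ _ \<phi>(2) mem(1) _ b' mem(2)])
         (use M N \<psi> g fv_rename[of \<psi> g] in \<open>auto simp: fm_of_rename atomic_model_def\<close>)
    also have "\<dots> = sat N (snd \<circ> v) \<psi>"
      unfolding sat_rename by (rule sat_cong) (use g nth in simp)
    finally show "sat M (fst \<circ> v) \<psi> = sat N (snd \<circ> v) \<psi>" .
  qed (use RMN a b in auto)
  then show thesis using that b by blast
qed

lemma pelem_extend_finite:
  fixes M :: "('a, 'f, 'r) struct" and N :: "('b, 'f, 'r) struct"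
  assumes M: "atomic_model L T M" and N: "models L N T"
    and R: "pelem L M N R" "finite R" and A: "finite A" "A \<subseteq> universe M"
  obtains S where "R \<subseteq> S" "finite S" "pelem L M N S" "A \<subseteq> Domain S"
proof -
  from A have "\<exists>S. R \<subseteq> S \<and> finite S \<and> pelem L M N S \<and> A \<subseteq> Domain S"
  proof (induction A)
    case empty
    then show ?case using R by blast
  next
    case (insert a A)
    then obtain S where S: "R \<subseteq> S" "finite S" "pelem L M N S" "A \<subseteq> Domain S" by auto
    obtain b where "pelem L M N (insert (a, b) S)"
      using pelem_extend[OF M N S(3,2), of a] insert.prems by blast
    then show ?case using S by (intro exI[of _ "insert (a, b) S"]) auto
  qed
  then show thesis using that by blast
qed

end

lemma elem_substructure_sat:
  assumes K: "elem_substructure L K M" and \<phi>: "fm_of L \<phi>" "v ` fv \<phi> \<subseteq> universe K"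
  shows "sat K v \<phi> = sat M v \<phi>"
proof -
  obtain a where a: "a \<in> universe K"
    using K by (auto simp: elem_substructure_def substructure_def structure_of_def)
  let ?w = "\<lambda>i. if i \<in> fv \<phi> then v i else a"
  have "sat K ?w \<phi> = sat M ?w \<phi>"
  proof -
    have "range ?w \<subseteq> universe K" using a \<phi> by auto
    then show ?thesis using K \<phi>(1) unfolding elem_substructure_def by blast
  qed
  moreover have "sat K v \<phi> = sat K ?w \<phi>" "sat M v \<phi> = sat M ?w \<phi>" by (rule sat_cong, simp)+
  ultimately show ?thesis by simp
qed

lemma pelem_elem_substructure:
  fixes K M :: "('a, 'f, 'r) struct"
  assumes K: "elem_substructure L K M" and A: "A \<subseteq> universe K"
  shows "pelem L K M (Id_on A)"
proof (rule pelemI)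
  have "universe K \<subseteq> universe M" using K by (simp add: elem_substructure_def substructure_def)
  then show "Id_on A \<subseteq> universe K \<times> universe M" using A by auto
  fix \<phi> :: "('f, 'r) fm" and v :: "nat \<Rightarrow> 'a \<times> 'a" assume \<phi>: "fm_of L \<phi>" "v ` fv \<phi> \<subseteq> Id_on A"
  have v: "fst (v i) \<in> A" "snd (v i) = fst (v i)" if "i \<in> fv \<phi>" for i
    using \<phi>(2) that by (force simp: Id_on_def)+
  have "sat K (fst \<circ> v) \<phi> = sat M (fst \<circ> v) \<phi>"
    by (rule elem_substructure_sat[OF K \<phi>(1)]) (use v A in auto)
  also have "\<dots> = sat M (snd \<circ> v) \<phi>"
    by (rule sat_cong) (use v in auto)
  finally show "sat K (fst \<circ> v) \<phi> = sat M (snd \<circ> v) \<phi>" .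
qed

text \<open>Complete formulas refer to \<open>T\<close> alone, so the one satisfied by the image
  tuple in \<open>M\<close> serves for the tuple in \<open>N\<close> as well. This covers elementary
  submodels and isomorphic copies at once.\<close>

lemma atomic_model_pelem:
  fixes M :: "('a, 'f, 'r) struct" and N :: "('b, 'f, 'r) struct"
  assumes T: "theory_of L T" and M: "atomic_model L T M" and N: "structure_of L N"
    and R: "pelem L N M R" "universe N \<subseteq> Domain R"
  shows "atomic_model L T N"
  unfolding atomic_model_def models_def
proof (intro conjI ballI allI impI)
  fix \<sigma> and v :: "nat \<Rightarrow> 'b" assume \<sigma>: "\<sigma> \<in> T"
  have s: "fm_of L \<sigma>" "fv \<sigma> = {}" using T \<sigma> by (auto simp: theory_of_def sentence_of_def)
  obtain a where a: "a \<in> universe M" using M by (auto simp: atomic_model_def models_def structure_of_def)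
  have "sat M (\<lambda>_. a) \<sigma>" using M a \<sigma> unfolding atomic_model_def models_def by (auto dest!: bspec[of T])
  moreover have "sat N v \<sigma> = sat M (\<lambda>_. a) \<sigma>" by (rule pelem_sat[OF R(1) s(1)]) (simp add: s(2))
  ultimately show "sat N v \<sigma>" by simp
next
  fix xs assume xs: "xs \<in> lists (universe N)"
  have "\<forall>i. \<exists>y. i < length xs \<longrightarrow> (xs ! i, y) \<in> R" using R(2) xs by force
  then obtain y where y: "\<And>i. i < length xs \<Longrightarrow> (xs ! i, y i) \<in> R" by metis
  let ?ys = "map y [0..<length xs]"
  have "R \<subseteq> universe N \<times> universe M" using R(1) by (simp add: pelem_def)
  then have "?ys \<in> lists (universe M)" using y by fastforce
  then obtain \<phi> where \<phi>: "complete_fm L T (length ?ys) \<phi>" "sat M (nth ?ys) \<phi>"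
    using M unfolding atomic_model_def by blast
  have "sat N (nth xs) \<phi> = sat M (nth ?ys) \<phi>"
    by (rule pelem_sat[OF R(1)]) (use \<phi>(1) y in \<open>auto simp: complete_fm_def\<close>)
  then show "\<exists>\<phi>. complete_fm L T (length xs) \<phi> \<and> sat N (nth xs) \<phi>" using \<phi> by auto
qed (rule N)

section \<open>Tarski--Vaught sets and pseudo-algebraic closure\<close>

text \<open>The Tarski-Vaught criterion as a property of the bare set. \<open>pcl\<close> quantifies
  over structure records, whose operations are arbitrary off the universe; sets can be pushed
  forward along an elementary relation directly.\<close>

definition tv :: "('f, 'r) lang \<Rightarrow> ('a, 'f, 'r) struct \<Rightarrow> 'a set \<Rightarrow> bool" where
  "tv L M S \<longleftrightarrow> S \<subseteq> universe M \<and> S \<noteq> {} \<and>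
    (\<forall>\<phi> x v. fm_of L \<phi> \<longrightarrow> v ` fv (Exists x \<phi>) \<subseteq> S \<longrightarrow> sat M v (Exists x \<phi>) \<longrightarrow>
      (\<exists>a \<in> S. sat M (v(x := a)) \<phi>))"

lemma tvD:
  assumes "tv L M S" "fm_of L \<phi>" "v ` fv (Exists x \<phi>) \<subseteq> S" "sat M v (Exists x \<phi>)"
  obtains a where "a \<in> S" "sat M (v(x := a)) \<phi>"
  using assms unfolding tv_def by blast

lemma eval_universe_update: "eval (M\<lparr>universe := S\<rparr>) v = eval M v"
proof
  fix t show "eval (M\<lparr>universe := S\<rparr>) v t = eval M v t"
    by (induction t) (auto cong: map_cong)
qed

lemma tv_imp_elem_substructure:
  assumes M: "structure_of L M" and S: "tv L M S"
  shows "elem_substructure L (M\<lparr>universe := S\<rparr>) M"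
proof -
  let ?N = "M\<lparr>universe := S\<rparr>"
  have SM: "S \<subseteq> universe M" "S \<noteq> {}" using S by (simp_all add: tv_def)
  have "fn M f xs \<in> S" if f: "f \<in> funs L" "xs \<in> lists S" "length xs = farity L f" for f xs
  proof -
    \<comment> \<open>Closure under \<open>f\<close> is the criterion for the formula saying that
      the last variable is the value of \<open>f\<close> at the others.\<close>
    let ?n = "length xs" and ?\<phi> = "Eq (Var (length xs)) (Fn f (map Var [0..<length xs]))"
    have nth: "map (\<lambda>i. if i = ?n then a else xs ! i) [0..<?n] = xs" for a
      by (rule nth_equalityI) auto
    have "fn M f xs \<in> universe M" using M f SM unfolding structure_of_def by (meson lists_mono subsetD)
    then have 1: "sat M (nth xs) (Exists ?n ?\<phi>)" using nth by (auto simp: fun_upd_def comp_def)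
    have 2: "nth xs ` fv (Exists ?n ?\<phi>) \<subseteq> S" using f by (auto simp: in_lists_conv_set)
    have 3: "fm_of L ?\<phi>" using f by simp
    obtain a where "a \<in> S" "sat M ((nth xs)(?n := a)) ?\<phi>" by (rule tvD[OF S 3 2 1])
    then show ?thesis using nth by (auto simp: fun_upd_def comp_def)
  qed
  then have "substructure L ?N M" using M SM by (auto simp: substructure_def structure_of_def)
  moreover have "sat ?N v \<phi> = sat M v \<phi>" if "fm_of L \<phi>" "range v \<subseteq> S" for \<phi> v
    using that
  proof (induction \<phi> arbitrary: v)
    case (Exists x \<phi>)
    have IH: "sat ?N (v(x := a)) \<phi> = sat M (v(x := a)) \<phi>" if "a \<in> S" for a
      by (rule Exists.IH) (use Exists.prems that in auto)
    have "\<exists>a \<in> S. sat M (v(x := a)) \<phi>" if "sat M v (Exists x \<phi>)"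
      by (rule tvD[OF S _ _ that]) (use Exists.prems in auto)
    then show ?case using IH SM by auto
  qed (auto simp: eval_universe_update)
  ultimately show ?thesis by (simp add: elem_substructure_def)
qed

lemma tv_elem_substructure:
  assumes K: "elem_substructure L K M" and S: "tv L K S"
  shows "tv L M S"
  unfolding tv_def
proof (intro conjI allI impI)
  have sub: "universe K \<subseteq> universe M" "S \<subseteq> universe K"
    using K S by (simp_all add: elem_substructure_def substructure_def tv_def)
  then show "S \<subseteq> universe M" by simp
  show "S \<noteq> {}" using S by (simp add: tv_def)
  fix \<phi> x v assume \<phi>: "fm_of L \<phi>" "v ` fv (Exists x \<phi>) \<subseteq> S" "sat M v (Exists x \<phi>)"
  have "sat K v (Exists x \<phi>)"
    using elem_substructure_sat[OF K, of "Exists x \<phi>" v] \<phi> sub by auto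
  then obtain a where a: "a \<in> S" "sat K (v(x := a)) \<phi>" using tvD[OF S \<phi>(1,2)] by blast
  moreover have "sat K (v(x := a)) \<phi> = sat M (v(x := a)) \<phi>"
    by (rule elem_substructure_sat[OF K \<phi>(1)]) (use a \<phi> sub in auto)
  ultimately show "\<exists>a \<in> S. sat M (v(x := a)) \<phi>" by blast
qed

lemma tv_restrict:
  assumes K: "elem_substructure L K M" and S: "tv L M S" "S \<subseteq> universe K"
  shows "tv L K S"
  unfolding tv_def
proof (intro conjI allI impI)
  show "S \<noteq> {}" using S by (simp add: tv_def)
  fix \<phi> x v assume \<phi>: "fm_of L \<phi>" "v ` fv (Exists x \<phi>) \<subseteq> S" "sat K v (Exists x \<phi>)"
  have "sat M v (Exists x \<phi>)"
    using elem_substructure_sat[OF K, of "Exists x \<phi>" v] \<phi> S by auto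
  then obtain a where a: "a \<in> S" "sat M (v(x := a)) \<phi>" using tvD[OF S(1) \<phi>(1,2)] by blast
  moreover have "sat K (v(x := a)) \<phi> = sat M (v(x := a)) \<phi>"
    by (rule elem_substructure_sat[OF K \<phi>(1)]) (use a \<phi> S in auto)
  ultimately show "\<exists>a \<in> S. sat K (v(x := a)) \<phi>" by blast
qed (rule S(2))

lemma tv_universe: "structure_of L M \<Longrightarrow> tv L M (universe M)"
  by (auto simp: tv_def structure_of_def)

lemma elem_substructure_imp_tv:
  assumes "elem_substructure L K M" shows "tv L M (universe K)"
proof -
  have "structure_of L K" using assms by (simp add: elem_substructure_def substructure_def)
  then show ?thesis using tv_elem_substructure[OF assms tv_universe] by blast
qed

lemma pcl_iff_tv:
  assumes "structure_of L M"
  shows "a \<in> pcl L M B \<longleftrightarrow> a \<in> universe M \<and> (\<forall>S. tv L M S \<longrightarrow> B \<subseteq> S \<longrightarrow> a \<in> S)"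
proof -
  have "a \<in> S" if "\<And>N. elem_substructure L N M \<Longrightarrow> B \<subseteq> universe N \<Longrightarrow> a \<in> universe N" "tv L M S" "B \<subseteq> S" for S
    using that(1)[OF tv_imp_elem_substructure[OF assms that(2)]] that(3) by simp
  then show ?thesis unfolding pcl_def using elem_substructure_imp_tv by blast
qed

lemma pcl_subset_universe: "pcl L M B \<subseteq> universe M"
  by (auto simp: pcl_def)

lemma pcl_superset: "B \<subseteq> universe M \<Longrightarrow> B \<subseteq> pcl L M B"
  by (auto simp: pcl_def)

lemma pcl_mono: "B \<subseteq> C \<Longrightarrow> pcl L M B \<subseteq> pcl L M C"
  unfolding pcl_def by blast

lemma pcl_trans: "C \<subseteq> pcl L M B \<Longrightarrow> pcl L M C \<subseteq> pcl L M B"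
  unfolding pcl_def by blast

lemma tv_Image:
  fixes M :: "('a, 'f, 'r) struct" and N :: "('b, 'f, 'r) struct"
  assumes R: "pelem L M N R" "Domain R = universe M" "Range R = universe N" and S: "tv L M S"
  shows "tv L N (R `` S)"
  unfolding tv_def
proof (intro conjI allI impI)
  have SM: "S \<subseteq> universe M" "S \<noteq> {}" using S by (simp_all add: tv_def)
  show "R `` S \<subseteq> universe N" using R by auto
  show "R `` S \<noteq> {}" using R SM by blast
  fix \<phi> x and v :: "nat \<Rightarrow> 'b"
  assume \<phi>: "fm_of L \<phi>" "v ` fv (Exists x \<phi>) \<subseteq> R `` S" "sat N v (Exists x \<phi>)"
  have "\<forall>i. \<exists>a. i \<in> fv (Exists x \<phi>) \<longrightarrow> a \<in> S \<and> (a, v i) \<in> R" using \<phi>(2) by fastforce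
  then obtain u where u: "\<And>i. i \<in> fv (Exists x \<phi>) \<Longrightarrow> u i \<in> S \<and> (u i, v i) \<in> R" by metis
  have "sat M u (Exists x \<phi>) = sat N v (Exists x \<phi>)"
    by (rule pelem_sat[OF R(1)]) (use \<phi> u in auto)
  then have "sat M u (Exists x \<phi>)" using \<phi> by simp
  moreover have "u ` fv (Exists x \<phi>) \<subseteq> S" using u by blast
  ultimately obtain a where a: "a \<in> S" "sat M (u(x := a)) \<phi>" using tvD[OF S \<phi>(1)] by blast
  obtain b where b: "(a, b) \<in> R" using a SM R by blast
  have "sat M (u(x := a)) \<phi> = sat N (v(x := b)) \<phi>"
    by (rule pelem_sat[OF R(1) \<phi>(1)]) (use u b in auto)
  then show "\<exists>b \<in> R `` S. sat N (v(x := b)) \<phi>" using a b by blast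
qed

text \<open>A Tarski-Vaught set around \<open>C\<close> is pushed forward to one around
  \<open>D\<close>, which contains \<open>b\<close>; injectivity of \<open>R\<close> brings this
  back to \<open>a\<close>.\<close>

lemma pcl_pelem:
  assumes st: "structure_of L M" "structure_of L N"
    and R: "pelem L M N R" "Domain R = universe M" "Range R = universe N"
    and a: "(a, b) \<in> R" "b \<in> pcl L N D" "D \<subseteq> R `` C"
  shows "a \<in> pcl L M C"
  unfolding pcl_iff_tv[OF st(1)]
proof (intro conjI allI impI)
  show "a \<in> universe M" using a R by auto
  fix S assume S: "tv L M S" "C \<subseteq> S"
  have "b \<in> R `` S" using a S tv_Image[OF R S(1)] unfolding pcl_iff_tv[OF st(2)] by blast
  then show "a \<in> S" using pelem_inj[OF R(1) _ a(1)] by blast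
qed

section \<open>Back-and-forth, and the invariance of \<open>pcl\<close>\<close>

context complete_countable_theory
begin

lemma pelem_back_and_forth:
  fixes M :: "('a, 'f, 'r) struct" and N :: "('b, 'f, 'r) struct"
  assumes M: "atomic_model L T M" "countable (universe M)"
    and N: "atomic_model L T N" "countable (universe N)"
    and R: "pelem L M N R" "finite R"
  obtains S where "R \<subseteq> S" "pelem L M N S" "Domain S = universe M" "Range S = universe N"
proof -
  have mM: "models L M T" and mN: "models L N T" by (rule atomic_model_models[OF M(1)], rule atomic_model_models[OF N(1)])
  have ne: "universe M \<noteq> {}" "universe N \<noteq> {}" using mM mN by (auto simp: models_def structure_of_def)
  let ?m = "from_nat_into (universe M)" and ?n = "from_nat_into (universe N)"
  define ok where "ok S \<longleftrightarrow> finite S \<and> pelem L M N S" for S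
  have step: "\<exists>S'. ok S' \<and> (S \<subseteq> S' \<and> ?m k \<in> Domain S' \<and> ?n k \<in> Range S')" if "ok S" for S k
  proof -
    have S: "finite S" "pelem L M N S" using that by (auto simp: ok_def)
    obtain b where b: "pelem L M N (insert (?m k, b) S)"
      by (rule pelem_extend[OF M(1) mN S(2,1) from_nat_into[OF ne(1)]])
    have "finite ((insert (?m k, b) S)\<inverse>)" using S by simp
    then obtain a where a: "pelem L N M (insert (?n k, a) ((insert (?m k, b) S)\<inverse>))"
      by (rule pelem_extend[OF N(1) mM pelem_converse[OF b] _ from_nat_into[OF ne(2)]])
    have "(insert (?n k, a) ((insert (?m k, b) S)\<inverse>))\<inverse> = {(a, ?n k), (?m k, b)} \<union> S" by auto
    then show ?thesis using pelem_converse[OF a] S unfolding ok_def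
      by (intro exI[of _ "{(a, ?n k), (?m k, b)} \<union> S"] conjI) auto
  qed
  \<comment> \<open>The clause for \<open>k = 0\<close> pins the start of the chain to
    \<open>R\<close>, which dependent choice would otherwise leave open.\<close>
  have "\<exists>S. \<forall>k. (ok (S k) \<and> (k = 0 \<longrightarrow> S k = R)) \<and>
      (S k \<subseteq> S (Suc k) \<and> ?m k \<in> Domain (S (Suc k)) \<and> ?n k \<in> Range (S (Suc k)))"
  proof (rule dependent_nat_choice)
    show "\<exists>S. ok S \<and> (0 = (0::nat) \<longrightarrow> S = R)" using R by (auto simp: ok_def)
  next
    fix S and k :: nat assume "ok S \<and> (k = 0 \<longrightarrow> S = R)"
    then show "\<exists>S'. (ok S' \<and> (Suc k = 0 \<longrightarrow> S' = R)) \<and>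
        (S \<subseteq> S' \<and> ?m k \<in> Domain S' \<and> ?n k \<in> Range S')"
      using step[of S k] by (metis nat.distinct(1))
  qed
  then obtain S where *: "\<forall>k. (ok (S k) \<and> (k = 0 \<longrightarrow> S k = R)) \<and>
      (S k \<subseteq> S (Suc k) \<and> ?m k \<in> Domain (S (Suc k)) \<and> ?n k \<in> Range (S (Suc k)))" ..
  have S0: "S 0 = R" and S: "\<And>k. pelem L M N (S k)" "\<And>k. S k \<subseteq> S (Suc k)"
    "\<And>k. ?m k \<in> Domain (S (Suc k))" "\<And>k. ?n k \<in> Range (S (Suc k))"
    using * unfolding ok_def by blast+
  have mono: "i \<le> j \<Longrightarrow> S i \<subseteq> S j" for i j by (rule lift_Suc_mono_le[of S]) (rule S(2))
  define U where "U = (\<Union>k. S k)"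
  have sub: "U \<subseteq> universe M \<times> universe N" using S(1) unfolding U_def pelem_def by blast
  have "pelem L M N U"
  proof (rule pelemI[OF sub])
    fix \<phi> and v :: "nat \<Rightarrow> 'a \<times> 'b" assume \<phi>: "fm_of L \<phi>" "v ` fv \<phi> \<subseteq> U"
    obtain k where "v ` fv \<phi> \<subseteq> S k"
      by (rule finite_subset_UN_mono[OF _ mono]) (use \<phi> in \<open>auto simp: U_def finite_fv\<close>)
    then show "sat M (fst \<circ> v) \<phi> = sat N (snd \<circ> v) \<phi>"
      using S(1) \<phi>(1) unfolding pelem_def by blast
  qed
  moreover have "a \<in> Domain U" if "a \<in> universe M" for a
    using S(3) from_nat_into_surj[OF M(2) that] unfolding U_def by blast
  moreover have "b \<in> Range U" if "b \<in> universe N" for b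
    using S(4) from_nat_into_surj[OF N(2) that] unfolding U_def by blast
  moreover have "R \<subseteq> U" using S0 by (auto simp: U_def)
  ultimately show thesis using that[of U] sub by blast
qed


lemma atomic_elem_substructure:
  assumes "atomic_model L T M" "elem_substructure L K M" shows "atomic_model L T K"
  by (rule atomic_model_pelem[OF theory_T assms(1) _ pelem_elem_substructure[OF assms(2) order_refl]])
     (use assms(2) in \<open>auto simp: elem_substructure_def substructure_def\<close>)

lemma countable_atomic_iso:
  fixes M :: "('a, 'f, 'r) struct" and N :: "('b, 'f, 'r) struct"
  assumes M: "atomic_model L T M" "countable (universe M)"
    and N: "atomic_model L T N" "countable (universe N)"
    and R: "pelem L M N R" "finite R"
  obtains h where "h ` universe M = universe N" "\<forall>(a, b) \<in> R. h a = b"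
    "\<forall>a \<in> universe M. \<forall>C \<subseteq> universe M. a \<in> pcl L M C \<longleftrightarrow> h a \<in> pcl L N (h ` C)"
proof -
  obtain S where S: "R \<subseteq> S" "pelem L M N S" "Domain S = universe M" "Range S = universe N"
    by (rule pelem_back_and_forth[OF M N R])
  define h where "h a = (SOME b. (a, b) \<in> S)" for a
  have h: "(a, h a) \<in> S" if "a \<in> universe M" for a
    unfolding h_def by (rule someI_ex) (use S that in blast)
  have hb: "h a = b" if "(a, b) \<in> S" for a b
    using pelem_inj[OF S(2) h that] that S(3) by blast
  have st: "structure_of L M" "structure_of L N"
    using M(1) N(1) by (simp_all add: atomic_model_def models_def)
  show thesis
  proof
    have "h a \<in> universe N" if "a \<in> universe M" for a using RangeI[OF h[OF that]] S(4) by simp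
    moreover have "b \<in> h ` universe M" if b: "b \<in> universe N" for b
    proof -
      obtain a where "(a, b) \<in> S" using b S(4) by (metis RangeE)
      then show ?thesis using hb S(3) by (metis DomainI image_eqI)
    qed
    ultimately show "h ` universe M = universe N" by blast
    show "\<forall>(a, b) \<in> R. h a = b" using S(1) hb by blast
    have "a \<in> pcl L M C \<longleftrightarrow> h a \<in> pcl L N (h ` C)" if a: "a \<in> universe M" "C \<subseteq> universe M" for a C
    proof -
      have hC: "h ` C \<subseteq> S `` C" "C \<subseteq> S\<inverse> `` (h ` C)"
        using h a(2) by (auto intro!: ImageI[OF _ imageI])
      have dom: "Domain (S\<inverse>) = universe N" "Range (S\<inverse>) = universe M" "(h a, a) \<in> S\<inverse>"
        using S(3,4) h[OF a(1)] by simp_all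
      have "h a \<in> pcl L N (h ` C)" if "a \<in> pcl L M C"
        by (rule pcl_pelem[OF st(2,1) pelem_converse[OF S(2)] dom that hC(2)])
      moreover have "a \<in> pcl L M C" if "h a \<in> pcl L N (h ` C)"
        by (rule pcl_pelem[OF st S(2-4) h[OF a(1)] that hC(1)])
      ultimately show ?thesis by blast
    qed
    then show "\<forall>a \<in> universe M. \<forall>C \<subseteq> universe M. a \<in> pcl L M C \<longleftrightarrow> h a \<in> pcl L N (h ` C)"
      by blast
  qed
qed

text \<open>A Tarski-Vaught set of \<open>K\<close> is one of \<open>M\<close>, which gives one
  direction. For the other, a set of \<open>M\<close> that omits \<open>a\<close> may leave
  \<open>K\<close>. It is shrunk to a countable one and put with \<open>a\<close> into a countable
  \<open>M1\<close>; then \<open>M1\<close> and \<open>K\<close> are isomorphic over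
  \<open>a\<close> and \<open>C\<close>, so \<open>a\<close> avoids the closure of \<open>C\<close>
  in \<open>K\<close> too.\<close>

lemma pcl_elem_substructure:
  fixes M K :: "('a, 'f, 'r) struct"
  assumes M: "atomic_model L T M" and K: "elem_substructure L K M" "countable (universe K)"
    and a: "a \<in> universe K" and C: "finite C" "C \<subseteq> universe K"
  shows "a \<in> pcl L M C \<longleftrightarrow> a \<in> pcl L K C"
proof
  have st: "structure_of L M" "structure_of L K" "universe K \<subseteq> universe M"
    using K(1) by (simp_all add: elem_substructure_def substructure_def)
  show "a \<in> pcl L K C" if "a \<in> pcl L M C"
    using that a tv_elem_substructure[OF K(1)] by (auto simp: pcl_iff_tv st)
  show "a \<in> pcl L M C" if aK: "a \<in> pcl L K C"
  proof (rule ccontr)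
    assume "a \<notin> pcl L M C"
    then obtain S where S: "tv L M S" "C \<subseteq> S" "a \<notin> S" using a st by (auto simp: pcl_iff_tv)
    let ?N = "M\<lparr>universe := S\<rparr>"
    have N: "elem_substructure L ?N M" by (rule tv_imp_elem_substructure[OF st(1) S(1)])
    then have stN: "structure_of L ?N" by (simp add: elem_substructure_def substructure_def)
    \<comment> \<open>\<open>C\<close> may be empty, whereas \<open>downward_LS\<close> starts from
      a non-empty set.\<close>
    obtain s where s: "s \<in> S" using S(1) by (auto simp: tv_def)
    obtain N1 where N1: "elem_substructure L N1 ?N" "insert s C \<subseteq> universe N1" "countable (universe N1)"
      by (rule downward_LS[OF countable_L stN, of "insert s C"]) (use s S C in \<open>auto intro: countable_finite\<close>)
    have N1S: "universe N1 \<subseteq> S" using N1(1) by (simp add: elem_substructure_def substructure_def)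
    have tvN1: "tv L M (universe N1)"
      by (rule tv_elem_substructure[OF N]) (rule elem_substructure_imp_tv[OF N1(1)])
    obtain M1 where M1: "elem_substructure L M1 M" "insert a (universe N1) \<subseteq> universe M1" "countable (universe M1)"
      by (rule downward_LS[OF countable_L st(1), of "insert a (universe N1)"])
         (use a N1 N1S S(1) st(3) in \<open>auto simp: tv_def\<close>)
    have "tv L M1 (universe N1)"
      by (rule tv_restrict[OF M1(1) tvN1]) (use M1 in auto)
    moreover have "structure_of L M1" using M1 by (simp add: elem_substructure_def substructure_def)
    ultimately have aM1: "a \<notin> pcl L M1 C" using N1 N1S S by (auto simp: pcl_iff_tv)
    have at: "atomic_model L T M1" "atomic_model L T K"
      by (rule atomic_elem_substructure[OF M M1(1)], rule atomic_elem_substructure[OF M K(1)])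
    have aC: "insert a C \<subseteq> universe M1" "insert a C \<subseteq> universe K" using M1 N1 a C by auto
    \<comment> \<open>The identity on these elements, read from \<open>M1\<close> up to
      \<open>M\<close> and then down to \<open>K\<close>.\<close>
    have p: "pelem L M1 K (Id_on (insert a C) O Id_on (insert a C))"
      by (rule pelem_relcomp[OF pelem_elem_substructure[OF M1(1) aC(1)]])
         (use pelem_converse[OF pelem_elem_substructure[OF K(1) aC(2)]] in simp)
    have fin: "finite (Id_on (insert a C) O Id_on (insert a C))"
      using C by (intro finite_relcomp) (simp_all add: Id_on_def)
    obtain h where "h ` universe M1 = universe K" and h: "\<forall>(x, y) \<in> Id_on (insert a C) O Id_on (insert a C). h x = y"
      "\<forall>a \<in> universe M1. \<forall>C \<subseteq> universe M1. a \<in> pcl L M1 C \<longleftrightarrow> h a \<in> pcl L K (h ` C)"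
      by (rule countable_atomic_iso[OF at(1) M1(3) at(2) K(2) p fin])
    have hh: "h x = x" if "x \<in> insert a C" for x
      using bspec[OF h(1) relcompI[OF Id_onI[OF that] Id_onI[OF that]]] by simp
    have "h ` C = C" using hh by auto
    moreover have "a \<in> pcl L M1 C \<longleftrightarrow> h a \<in> pcl L K (h ` C)" using h(2) aC by blast
    ultimately show False using aM1 aK hh by simp
  qed
qed

text \<open>Exchange concerns finitely many elements at a time, so it can be checked in a countable
  submodel. Such a submodel of \<open>N\<close> is isomorphic to one of \<open>M\<close>, and
  \<open>pcl_elem_substructure\<close> ties both to the large models.\<close>

lemma pseudominimal_transfer:
  fixes M :: "('a, 'f, 'r) struct" and N :: "('b, 'f, 'r) struct"
  assumes M: "atomic_model L T M" "pseudominimal L M" and N: "atomic_model L T N"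
  shows "pseudominimal L N"
  unfolding pseudominimal_def
proof (intro allI impI)
  fix C a b
  assume C: "finite C" "C \<subseteq> universe N" and ab: "a \<in> universe N" "b \<in> universe N"
    and b: "b \<in> pcl L N (insert a C)" "b \<notin> pcl L N C"
  have st: "structure_of L M" "structure_of L N"
    using M N by (simp_all add: atomic_model_def models_def)
  obtain K where K: "elem_substructure L K N" "insert a (insert b C) \<subseteq> universe K" "countable (universe K)"
    by (rule downward_LS[OF countable_L st(2), of "insert a (insert b C)"]) (use C ab in \<open>auto intro: countable_finite\<close>)
  obtain m where m: "m \<in> universe M" using st(1) by (auto simp: structure_of_def)
  obtain H where H: "elem_substructure L H M" "countable (universe H)"
    by (rule downward_LS[OF countable_L st(1), of "{m}"]) (use m in auto)
  have at: "atomic_model L T K" "atomic_model L T H"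
    by (rule atomic_elem_substructure[OF N K(1)], rule atomic_elem_substructure[OF M(1) H(1)])
  have p: "pelem L K H {}"
    by (rule pelem_empty) (use at in \<open>simp_all add: atomic_model_models\<close>)
  obtain h where h: "h ` universe K = universe H" "\<forall>(a, b) \<in> {}. h a = b"
    "\<forall>a \<in> universe K. \<forall>C \<subseteq> universe K. a \<in> pcl L K C \<longleftrightarrow> h a \<in> pcl L H (h ` C)"
    by (rule countable_atomic_iso[OF at(1) K(3) at(2) H(2) p finite.emptyI])
  have tr: "x \<in> pcl L N D \<longleftrightarrow> h x \<in> pcl L M (h ` D)" if D: "x \<in> universe K" "D \<subseteq> universe K" "finite D" for x D
  proof -
    have "x \<in> pcl L N D \<longleftrightarrow> x \<in> pcl L K D" by (rule pcl_elem_substructure[OF N K(1,3) D(1,3,2)])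
    also have "\<dots> \<longleftrightarrow> h x \<in> pcl L H (h ` D)" using h(3) D(1,2) by blast
    also have "\<dots> \<longleftrightarrow> h x \<in> pcl L M (h ` D)"
      by (rule pcl_elem_substructure[OF M(1) H, symmetric]) (use h(1) D in auto)
    finally show ?thesis .
  qed
  have HM: "h x \<in> universe M" if "x \<in> universe K" for x
    using that h(1) H(1) by (auto simp: elem_substructure_def substructure_def)
  have "h b \<in> pcl L M (insert (h a) (h ` C))" "h b \<notin> pcl L M (h ` C)"
    using tr[of b "insert a C"] tr[of b C] K C b by simp_all
  moreover have "h ` C \<subseteq> universe M" "h a \<in> universe M" "h b \<in> universe M" using HM K(2) by auto
  ultimately have "h a \<in> pcl L M (insert (h b) (h ` C))"
    using M(2) C(1) unfolding pseudominimal_def by blast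
  then show "a \<in> pcl L N (insert b C)" using tr[of a "insert b C"] K C by simp
qed

end

lemma finite_Id_on: "finite A \<Longrightarrow> finite (Id_on A)"
  by (rule finite_subset[of _ "A \<times> A"]) auto

section \<open>Free amalgamation over independent sets\<close>

locale countable_pseudominimal = complete_countable_theory L T
  for L :: "('f, 'r) lang" and T +
  fixes M :: "('a, 'f, 'r) struct"
  assumes atomic_M: "atomic_model L T M" and countable_M: "countable (universe M)"
    and pseudominimal_M: "pseudominimal L M"
begin

abbreviation cl :: "'a set \<Rightarrow> 'a set" where
  "cl \<equiv> pcl L M"

lemma models_M: "models L M T"
  by (rule atomic_model_models[OF atomic_M])

lemma structure_M: "structure_of L M"
  using models_M by (simp add: models_def)

lemma cl_mono: "a \<in> cl B \<Longrightarrow> B \<subseteq> C \<Longrightarrow> a \<in> cl C"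
  using pcl_mono[of B C L M] by blast

lemma cl_exchange:
  assumes "finite C" "C \<subseteq> universe M" "a \<in> universe M" "b \<in> cl (insert a C)" "b \<notin> cl C"
  shows "a \<in> cl (insert b C)"
proof -
  have "b \<in> universe M" using subsetD[OF pcl_subset_universe assms(4)] .
  then show ?thesis using pseudominimal_M assms unfolding pseudominimal_def by blast
qed

text \<open>Homogeneity: a finite elementary map of a countable atomic model extends to an
  automorphism. The two tuples are given as assignments on a common set of names, the form in which
  configurations and their copies occur.\<close>

lemma pelem_pcl_iff:
  assumes R: "pelem L M M ((\<lambda>b. (e b, e' b)) ` B)" and B: "finite B" and c: "c \<in> B" "D \<subseteq> B"
  shows "e c \<in> cl (e ` D) \<longleftrightarrow> e' c \<in> cl (e' ` D)"
proof -
  have RM: "(\<lambda>b. (e b, e' b)) ` B \<subseteq> universe M \<times> universe M" using R unfolding pelem_def by blast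
  obtain h where "h ` universe M = universe M" and h: "\<forall>(a, b) \<in> (\<lambda>b. (e b, e' b)) ` B. h a = b"
    "\<forall>a \<in> universe M. \<forall>C \<subseteq> universe M. a \<in> cl C \<longleftrightarrow> h a \<in> cl (h ` C)"
    by (rule countable_atomic_iso[OF atomic_M countable_M atomic_M countable_M R finite_imageI[OF B]])
  have he: "h (e b) = e' b" if "b \<in> B" for b using bspec[OF h(1) imageI[OF that]] by simp
  have "e c \<in> universe M" "e ` D \<subseteq> universe M" using RM c by auto
  then have "e c \<in> cl (e ` D) \<longleftrightarrow> h (e c) \<in> cl (h ` e ` D)" using h(2) by blast
  also have "h ` e ` D = e' ` D" unfolding image_image by (rule image_cong[OF refl]) (use he c in blast)
  finally show ?thesis using he c by simp
qed

definition indep :: "'a set \<Rightarrow> bool" where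
  "indep X \<longleftrightarrow> finite X \<and> X \<subseteq> universe M \<and> (\<forall>x \<in> X. x \<notin> cl (X - {x}))"

text \<open>Exchange enters here. If \<open>x\<close> fell into the closure of \<open>y\<close> and
  the rest of \<open>X\<close>, then, being outside the closure of that rest, it would pull
  \<open>y\<close> into the closure of \<open>X\<close>.\<close>

lemma indep_insert:
  assumes X: "indep X" and y: "y \<in> universe M" "y \<notin> cl X"
  shows "indep (insert y X)"
  unfolding indep_def
proof (intro conjI ballI)
  have XM: "finite X" "X \<subseteq> universe M" using X by (simp_all add: indep_def)
  then show "finite (insert y X)" "insert y X \<subseteq> universe M" using y by simp_all
  have yX: "y \<notin> X" using y pcl_superset[OF XM(2)] by blast
  fix x assume x: "x \<in> insert y X"
  show "x \<notin> cl (insert y X - {x})"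
  proof (cases "x = y")
    case True
    then show ?thesis using y yX by simp
  next
    case False
    then have xX: "x \<in> X" "insert x (X - {x}) = X" "insert y X - {x} = insert y (X - {x})" using x by auto
    have "x \<notin> cl (X - {x})" using X xX(1) by (simp add: indep_def)
    moreover have "y \<notin> cl (insert x (X - {x}))" using xX(2) y(2) by simp
    ultimately show ?thesis
      unfolding xX(3) using cl_exchange[of "X - {x}" y x] XM y(1) by blast
  qed
qed

text \<open>The parameters \<open>C\<close> need only lie in the closure of \<open>Y\<close>, so
  dependent elements may be among them.\<close>

lemma indep_notin:
  assumes "indep X" "x \<in> X" "Y \<subseteq> X" "x \<notin> Y" "C \<subseteq> cl Y"
  shows "x \<notin> cl C"
proof -
  have "cl C \<subseteq> cl (X - {x})"
    using pcl_trans[OF assms(5)] pcl_mono[of Y "X - {x}" L M] assms by blast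
  then show ?thesis using assms(1,2) by (auto simp: indep_def)
qed

text \<open>An element outside the closure of the range is easily found, but \<open>E\<close> may
  determine it. An elementary submodel around the range omits this element; \<open>E\<close> is
  copied into that submodel over the range, where it cannot determine the element, and the copying
  is then undone.\<close>

lemma pelem_extend_indep:
  assumes R: "pelem L M M R" "finite R" and b: "b \<in> universe M" "b \<notin> cl (Domain R)"
    and E: "finite E" "E \<subseteq> universe M"
  obtains b' where "b' \<in> universe M" "b' \<notin> cl (E \<union> Range R)" "pelem L M M (insert (b, b') R)"
proof -
  have ends: "fst ` Q = Domain Q" "snd ` Q = Range Q" for Q :: "('a \<times> 'a) set" by force+
  \<comment> \<open>\<open>b1\<close> has the right type over the range of \<open>R\<close>, but may
    still depend on \<open>E\<close>.\<close>
  obtain b1 where b1: "b1 \<in> universe M" "pelem L M M (insert (b, b1) R)"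
    by (rule pelem_extend[OF atomic_M models_M R b(1)])
  have "fst (b, b1) \<in> cl (fst ` R) \<longleftrightarrow> snd (b, b1) \<in> cl (snd ` R)"
    by (rule pelem_pcl_iff[where B = "insert (b, b1) R"]) (use b1 R(2) in auto)
  then have "b1 \<notin> cl (Range R)" using b(2) by (simp add: ends)
  then obtain S where S: "tv L M S" "Range R \<subseteq> S" "b1 \<notin> S"
    using b1(1) by (auto simp: pcl_iff_tv[OF structure_M])
  let ?N = "M\<lparr>universe := S\<rparr>"
  have N: "elem_substructure L ?N M" by (rule tv_imp_elem_substructure[OF structure_M S(1)])
  have mN: "models L ?N T" by (rule atomic_model_models[OF atomic_elem_substructure[OF atomic_M N]])
  have S': "Range R \<subseteq> universe ?N" using S by simp
  have Id: "pelem L M ?N (Id_on (Range R))"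
    using pelem_converse[OF pelem_elem_substructure[OF N S']] by simp
  have RM: "Range R \<subseteq> universe M" using R(1) by (auto simp: pelem_def)
  have fin: "finite (Id_on (Range R))" using R(2) by (simp add: Id_on_def finite_Range)
  \<comment> \<open>\<open>Q\<close> moves \<open>E\<close> into the submodel that omits
    \<open>b1\<close>, fixing the range of \<open>R\<close>.\<close>
  obtain Q where Q: "Id_on (Range R) \<subseteq> Q" "finite Q" "pelem L M ?N Q" "E \<subseteq> Domain Q"
    by (rule pelem_extend_finite[OF atomic_M mN Id fin E])
  have QS: "Range Q \<subseteq> universe ?N" using Q(3) by (auto simp: pelem_def)
  have "pelem L M M (Q O Id_on (Range Q))"
    by (rule pelem_relcomp[OF Q(3) pelem_elem_substructure[OF N QS]])
  then have "pelem L M M Q" by (rule pelem_mono) auto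
  then have Q': "pelem L M M (Q\<inverse>)" "finite (Q\<inverse>)" using Q(2) pelem_converse by auto
  \<comment> \<open>Moving back along \<open>Q\<close> turns independence of \<open>b1\<close> over
    the range of \<open>Q\<close> into independence of \<open>b'\<close> over its domain, which
    contains \<open>E\<close>.\<close>
  obtain b' where b': "b' \<in> universe M" "pelem L M M (insert (b1, b') (Q\<inverse>))"
    by (rule pelem_extend[OF atomic_M models_M Q' b1(1)])
  have "fst (b1, b') \<in> cl (fst ` Q\<inverse>) \<longleftrightarrow> snd (b1, b') \<in> cl (snd ` Q\<inverse>)"
    by (rule pelem_pcl_iff[where B = "insert (b1, b') (Q\<inverse>)"]) (use b' Q'(2) in auto)
  moreover have "b1 \<notin> cl (Range Q)" using S(1,3) QS by (auto simp: pcl_iff_tv[OF structure_M])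
  ultimately have "b' \<notin> cl (Domain Q)" by (simp add: ends)
  moreover have "E \<union> Range R \<subseteq> Domain Q" using Q(1,4) by blast
  ultimately have "b' \<notin> cl (E \<union> Range R)" using cl_mono by blast
  moreover have "pelem L M M (insert (b, b') R)"
  proof (rule pelem_mono[OF pelem_relcomp[OF b1(2) b'(2)]])
    have "(y, y) \<in> Q\<inverse>" if "(x, y) \<in> R" for x y using that Q(1) by blast
    then have "R \<subseteq> R O Q\<inverse>" by auto
    moreover have "R O Q\<inverse> \<subseteq> insert (b, b1) R O insert (b1, b') (Q\<inverse>)"
      by (rule relcomp_mono) auto
    moreover have "(b, b') \<in> insert (b, b1) R O insert (b1, b') (Q\<inverse>)" by auto
    ultimately show "insert (b, b') R \<subseteq> insert (b, b1) R O insert (b1, b') (Q\<inverse>)" by auto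
  qed
  ultimately show thesis using that b'(1) by blast
qed

text \<open>\<open>C\<close> is what stays fixed, \<open>C0\<close> a base for it, and
  \<open>A0\<close> the independent elements to be copied. They are copied one at a time: the next
  one is outside the closure of \<open>C\<close> and those already treated, so
  \<open>pelem_extend_indep\<close> applies.\<close>

lemma free_copy:
  assumes C: "finite C" "C0 \<subseteq> C" "C \<subseteq> cl C0" and A: "indep (C0 \<union> A0)" "C0 \<inter> A0 = {}"
  obtains g where "pelem L M M (Id_on C \<union> (\<lambda>a. (a, g a)) ` A0)" "indep (C0 \<union> A0 \<union> g ` A0)"
    "inj_on g A0" "g ` A0 \<inter> (C0 \<union> A0) = {}"
proof -
  have fin: "finite A0" and sub: "A0 \<subseteq> universe M" "C0 \<subseteq> universe M"
    using A(1) by (auto simp: indep_def)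
  have CM: "C \<subseteq> universe M" by (rule order_trans[OF C(3) pcl_subset_universe])
  have "\<exists>g. pelem L M M (Id_on C \<union> (\<lambda>a. (a, g a)) ` A0) \<and> indep (C0 \<union> A0 \<union> g ` A0) \<and>
    inj_on g A0 \<and> g ` A0 \<inter> (C0 \<union> A0) = {}"
  proof (rule finite_subset_induct'[OF fin order_refl, where P = "\<lambda>A1. \<exists>g.
      pelem L M M (Id_on C \<union> (\<lambda>a. (a, g a)) ` A1) \<and> indep (C0 \<union> A0 \<union> g ` A1) \<and>
      inj_on g A1 \<and> g ` A1 \<inter> (C0 \<union> A0) = {}"])
    show "\<exists>g. pelem L M M (Id_on C \<union> (\<lambda>a. (a, g a)) ` {}) \<and> indep (C0 \<union> A0 \<union> g ` {}) \<and>
      inj_on g {} \<and> g ` {} \<inter> (C0 \<union> A0) = {}"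
      using pelem_Id_on[OF CM] A by simp
  next
    fix a A1 assume a: "a \<in> A0" and A1: "finite A1" "A1 \<subseteq> A0" "a \<notin> A1"
      and "\<exists>g. pelem L M M (Id_on C \<union> (\<lambda>a. (a, g a)) ` A1) \<and> indep (C0 \<union> A0 \<union> g ` A1) \<and>
        inj_on g A1 \<and> g ` A1 \<inter> (C0 \<union> A0) = {}"
    then obtain g where g: "pelem L M M (Id_on C \<union> (\<lambda>a. (a, g a)) ` A1)" "indep (C0 \<union> A0 \<union> g ` A1)"
      "inj_on g A1" "g ` A1 \<inter> (C0 \<union> A0) = {}" by blast
    let ?R = "Id_on C \<union> (\<lambda>a. (a, g a)) ` A1"
    have R: "finite ?R" "Domain ?R = C \<union> A1" "Range ?R = C \<union> g ` A1"
      using C(1) A1(1) by (auto simp: Id_on_def)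
    have CA1: "C \<union> A1 \<subseteq> cl (C0 \<union> A1)"
      using C(3) pcl_mono[of C0 "C0 \<union> A1" L M] pcl_superset[of "C0 \<union> A1" M L] sub A1(2) by blast
    have "a \<notin> cl (Domain ?R)" unfolding R(2)
      by (rule indep_notin[OF A(1) _ _ _ CA1]) (use a A A1 in auto)
    \<comment> \<open>\<open>A0\<close> takes the place of \<open>E\<close>, so the new element is
      independent of all originals, including those still to be copied.\<close>
    then obtain b where b: "b \<in> universe M" "b \<notin> cl (A0 \<union> Range ?R)" "pelem L M M (insert (a, b) ?R)"
      using pelem_extend_indep[OF g(1) R(1) _ _ fin sub(1)] a sub by blast
    have "C0 \<union> A0 \<union> g ` A1 \<subseteq> A0 \<union> Range ?R" unfolding R(3) using C(2) by blast
    then have b': "b \<notin> cl (C0 \<union> A0 \<union> g ` A1)" using b(2) cl_mono by blast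
    have bn: "b \<notin> C0 \<union> A0 \<union> g ` A1"
      using b' pcl_superset[of "C0 \<union> A0 \<union> g ` A1" M L] g(2) by (auto simp: indep_def)
    let ?g = "g(a := b)"
    have im: "?g ` insert a A1 = insert b (g ` A1)" "(\<lambda>a. (a, ?g a)) ` insert a A1 = insert (a, b) ((\<lambda>a. (a, g a)) ` A1)"
      using A1(3) by (auto simp: image_iff)
    have "pelem L M M (Id_on C \<union> (\<lambda>a. (a, ?g a)) ` insert a A1)" using b(3) unfolding im by simp
    moreover have "indep (C0 \<union> A0 \<union> ?g ` insert a A1)"
      unfolding im using indep_insert[OF g(2) b(1) b'] by simp
    moreover have "inj_on ?g (insert a A1)"
      using g(3) bn A1(3) by (auto simp: inj_on_def)
    moreover have "?g ` insert a A1 \<inter> (C0 \<union> A0) = {}" unfolding im using g(4) bn by blast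
    ultimately show "\<exists>g. pelem L M M (Id_on C \<union> (\<lambda>a. (a, g a)) ` insert a A1) \<and>
        indep (C0 \<union> A0 \<union> g ` insert a A1) \<and> inj_on g (insert a A1) \<and>
        g ` insert a A1 \<inter> (C0 \<union> A0) = {}" by blast
  qed
  then show thesis using that by blast
qed

section \<open>Finite labelled configurations\<close>

text \<open>
  A name \<open>(i, Z)\<close> stands for an element of the finite approximation that depends on the nodes
  in \<open>Z\<close>; the names \<open>(0, {x})\<close> denote the independent elements that are split along the tree.
\<close>

definition conf :: "nat set \<Rightarrow> (nat \<times> nat set) set \<Rightarrow> (nat \<times> nat set) set \<Rightarrow> (nat \<times> nat set \<Rightarrow> 'a) \<Rightarrow> bool"
  where "conf X B B0 e \<longleftrightarrow> finite B \<and> B0 \<subseteq> B \<and> (\<forall>b \<in> B. snd b \<subseteq> X) \<and> e ` B \<subseteq> universe M \<and>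
    inj_on e B0 \<and> indep (e ` B0) \<and> (\<forall>b \<in> B. e b \<in> cl (e ` {c \<in> B0. snd c \<subseteq> snd b})) \<and>
    (\<forall>x \<in> X. (0, {x}) \<in> B0)"

lemma conf_span: "conf X B B0 e \<Longrightarrow> e ` B \<subseteq> cl (e ` B0)"
proof
  fix y assume c: "conf X B B0 e" and "y \<in> e ` B"
  then obtain b where "y = e b" "e b \<in> cl (e ` {c \<in> B0. snd c \<subseteq> snd b})" by (auto simp: conf_def)
  then show "y \<in> cl (e ` B0)" using pcl_mono[of "e ` {c \<in> B0. snd c \<subseteq> snd b}" "e ` B0" L M] by blast
qed

definition relabel :: "nat \<Rightarrow> nat \<Rightarrow> nat \<times> nat set \<Rightarrow> nat \<times> nat set" where
  "relabel x y b = (fst b, (id(x := y)) ` snd b)"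

lemma relabel_id: "x \<notin> snd b \<Longrightarrow> relabel x y b = b"
  by (cases b) (auto simp: relabel_def fun_upd_def)

lemma relabel_relabel: "y \<notin> snd b \<Longrightarrow> relabel y x (relabel x y b) = b"
  by (cases b) (auto simp: relabel_def fun_upd_def image_iff split: if_splits)

lemma mem_relabel: "x \<in> snd b \<Longrightarrow> y \<in> snd (relabel x y b)"
  by (auto simp: relabel_def)

text \<open>Splitting of one node \<open>x\<close>, with \<open>y\<close> as its new twin. The base
  elements involving \<open>x\<close> receive a free copy over everything else, and the elements
  depending on them follow by extension of the elementary map.\<close>

lemma conf_copy:
  assumes c: "conf X B B0 e" and x: "x \<in> X" "y \<notin> X"
  obtains B' B0' e' where "conf (insert y X) B' B0' e'" "B \<subseteq> B'" "relabel x y ` B \<subseteq> B'"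
    "\<forall>b \<in> B. e' b = e b" "pelem L M M ((\<lambda>b. (e b, e' (relabel x y b))) ` B)"
proof -
  note [simp] = relabel_id
  have B: "finite B" "B0 \<subseteq> B" "\<And>b. b \<in> B \<Longrightarrow> snd b \<subseteq> X" "e ` B \<subseteq> universe M" "inj_on e B0"
    "indep (e ` B0)" "\<And>b. b \<in> B \<Longrightarrow> e b \<in> cl (e ` {c \<in> B0. snd c \<subseteq> snd b})" "\<And>x. x \<in> X \<Longrightarrow> (0, {x}) \<in> B0"
    using c unfolding conf_def by blast+
  let ?\<tau> = "relabel x y"
  define CB where "CB = {b \<in> B. x \<notin> snd b}"
  define C0 where "C0 = e ` {b \<in> B0. x \<notin> snd b}"
  define A0 where "A0 = e ` {b \<in> B0. x \<in> snd b}"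
  have un: "C0 \<union> A0 = e ` B0" by (auto simp: C0_def A0_def)
  have dis: "C0 \<inter> A0 = {}" using B(5) by (auto simp: C0_def A0_def inj_on_def)
  have C0: "C0 \<subseteq> e ` CB" using B(2) by (auto simp: C0_def CB_def)
  \<comment> \<open>The labels are used here: a name without \<open>x\<close> depends only on base
    names with smaller labels, which also lack \<open>x\<close>.\<close>
  have Ccl: "e ` CB \<subseteq> cl C0"
  proof
    fix z assume "z \<in> e ` CB"
    then obtain b where b: "b \<in> B" "x \<notin> snd b" "z = e b" by (auto simp: CB_def)
    have "e ` {c \<in> B0. snd c \<subseteq> snd b} \<subseteq> C0" using b(2) by (auto simp: C0_def)
    then show "z \<in> cl C0" using B(7)[OF b(1)] cl_mono b(3) by blast
  qed
  have finC: "finite (e ` CB)" using B(1) by (simp add: CB_def)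
  obtain g where g: "pelem L M M (Id_on (e ` CB) \<union> (\<lambda>a. (a, g a)) ` A0)" "indep (e ` B0 \<union> g ` A0)"
    "inj_on g A0" "g ` A0 \<inter> e ` B0 = {}"
    using free_copy[OF finC C0 Ccl] un dis B(6) by metis
  have "finite (Id_on (e ` CB) \<union> (\<lambda>a. (a, g a)) ` A0)"
    using finC finite_subset[OF B(2,1)] by (simp add: finite_Id_on A0_def)
  then obtain S where S: "Id_on (e ` CB) \<union> (\<lambda>a. (a, g a)) ` A0 \<subseteq> S" "pelem L M M S" "e ` B \<subseteq> Domain S"
    using pelem_extend_finite[OF atomic_M models_M g(1) _ finite_imageI[OF B(1)] B(4)] by metis
  \<comment> \<open>\<open>k\<close> copies the whole configuration: it agrees with \<open>g\<close>
    on base elements involving \<open>x\<close> and is the identity on elements not involving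
    \<open>x\<close>.\<close>
  define k where "k a = (SOME b. (a, b) \<in> S)" for a
  have k: "(e b, k (e b)) \<in> S" if "b \<in> B" for b
    unfolding k_def by (rule someI_ex) (use S(3) that in auto)
  have kC: "k (e b) = e b" if "b \<in> CB" for b
  proof -
    have "(e b, e b) \<in> S" "b \<in> B" using S(1) that by (auto simp: CB_def)
    then show ?thesis using pelem_inj[OF S(2) k] by blast
  qed
  have kA: "k (e b) = g (e b)" if "b \<in> B0" "x \<in> snd b" for b
  proof -
    have "(e b, g (e b)) \<in> S" "b \<in> B" using S(1) that B(2) by (auto simp: A0_def)
    then show ?thesis using pelem_inj[OF S(2) k] by blast
  qed
  \<comment> \<open>Old names keep their values. A name containing \<open>y\<close> is new, and
    relabelling \<open>y\<close> to \<open>x\<close> recovers its original.\<close>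
  define e' where "e' b = (if b \<in> B then e b else k (e (relabel y x b)))" for b
  have e'B: "e' b = e b" if "b \<in> B" for b using that by (simp add: e'_def)
  have y: "y \<notin> snd b" if "b \<in> B" for b using B(3)[OF that] x by blast
  have new: "?\<tau> b \<notin> B" if "x \<in> snd b" for b using y mem_relabel[OF that] by blast
  have e'\<tau>: "e' (?\<tau> b) = k (e b)" if b: "b \<in> B" for b
  proof (cases "x \<in> snd b")
    case True
    then show ?thesis using new[OF True] relabel_relabel[OF y[OF b]] by (simp add: e'_def)
  next
    case False
    then show ?thesis using b kC by (simp add: e'_def CB_def)
  qed
  let ?B = "B \<union> ?\<tau> ` B" and ?Q = "B0 \<union> ?\<tau> ` B0"
  have pel: "pelem L M M ((\<lambda>b. (e b, e' (?\<tau> b))) ` B)"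
    by (rule pelem_mono[OF S(2)]) (use k e'\<tau> in auto)
  have B0': "?Q = B0 \<union> ?\<tau> ` {b \<in> B0. x \<in> snd b}" 
  proof -
    have "?\<tau> b \<in> B0 \<or> b \<in> {b \<in> B0. x \<in> snd b}" if "b \<in> B0" for b using that by (cases "x \<in> snd b") auto
    then show ?thesis by blast
  qed
  have e'A: "e' (?\<tau> b) = g (e b)" if "b \<in> B0" "x \<in> snd b" for b
    using that e'\<tau>[OF subsetD[OF B(2) that(1)]] kA[OF that] by simp
  have im: "e' ` B0 = e ` B0" "e' ` ?\<tau> ` {b \<in> B0. x \<in> snd b} = g ` A0"
  proof -
    show "e' ` B0 = e ` B0" by (rule image_cong[OF refl]) (use e'B B(2) in blast)
    show "e' ` ?\<tau> ` {b \<in> B0. x \<in> snd b} = g ` A0"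
      unfolding A0_def image_image by (rule image_cong[OF refl]) (use e'A in blast)
  qed
  have "conf (insert y X) ?B ?Q e'"
    unfolding conf_def
  proof (intro conjI ballI)
    show "finite ?B" "?Q \<subseteq> ?B" using B(1,2) by auto
    show "snd b \<subseteq> insert y X" if "b \<in> ?B" for b
      using that B(3) by (fastforce simp: relabel_def)
    have "k (e b) \<in> universe M" if "b \<in> B" for b using k[OF that] S(2) by (auto simp: pelem_def)
    then show "e' ` ?B \<subseteq> universe M" using B(4) e'B e'\<tau> by auto
    show "indep (e' ` ?Q)" unfolding B0' image_Un im by (rule g(2))
    have "inj_on e' B0" using inj_on_cong[of B0 e' e] B(5) e'B subsetD[OF B(2)] by simp
    moreover have "inj_on e' (?\<tau> ` {b \<in> B0. x \<in> snd b})"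
    proof (rule inj_onI)
      fix p q assume "p \<in> ?\<tau> ` {b \<in> B0. x \<in> snd b}" "q \<in> ?\<tau> ` {b \<in> B0. x \<in> snd b}" and eq: "e' p = e' q"
      then obtain b d where b: "b \<in> B0" "x \<in> snd b" "p = ?\<tau> b" and d: "d \<in> B0" "x \<in> snd d" "q = ?\<tau> d"
        by blast
      have A: "e b \<in> A0" "e d \<in> A0" using b d by (simp_all add: A0_def)
      have "g (e b) = g (e d)" using eq e'A[OF b(1,2)] e'A[OF d(1,2)] b(3) d(3) by simp
      then have "b = d" using inj_onD[OF g(3) _ A] inj_onD[OF B(5) _ b(1) d(1)] by simp
      then show "p = q" using b(3) d(3) by simp
    qed
    moreover have "e' ` B0 \<inter> e' ` ?\<tau> ` {b \<in> B0. x \<in> snd b} = {}" unfolding im using g(4) by blast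
    ultimately show "inj_on e' ?Q" unfolding B0' inj_on_Un by blast
    show "(0, {z}) \<in> ?Q" if "z \<in> insert y X" for z
    proof (cases "z = y")
      case True
      have "?\<tau> (0, {x}) = (0, {y})" by (simp add: relabel_def)
      then show ?thesis using True B(8)[OF x(1)] by (metis UnI2 image_eqI)
    next
      case False
      then show ?thesis using that B(8) by blast
    qed
    fix b assume "b \<in> ?B"
    then consider "b \<in> B" | d where "d \<in> B" "b = ?\<tau> d" by blast
    then show "e' b \<in> cl (e' ` {c \<in> ?Q. snd c \<subseteq> snd b})"
    proof cases
      case 1
      have "e ` {c \<in> B0. snd c \<subseteq> snd b} = e' ` {c \<in> B0. snd c \<subseteq> snd b}"
        by (rule image_cong) (use e'B B(2) in auto)
      also have "\<dots> \<subseteq> e' ` {c \<in> ?Q. snd c \<subseteq> snd b}" by (rule image_mono) blast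
      finally show ?thesis using B(7)[OF 1] e'B[OF 1] cl_mono by simp
    next
      case 2
      let ?D = "{c \<in> B0. snd c \<subseteq> snd d}"
      \<comment> \<open>The copy depends on the relabelled base names exactly as the original
        depends on the old ones.\<close>
      have "e d \<in> cl (e ` ?D) \<longleftrightarrow> e' (?\<tau> d) \<in> cl ((\<lambda>b. e' (?\<tau> b)) ` ?D)"
        by (rule pelem_pcl_iff[OF pel B(1) 2(1)]) (use B(2) in auto)
      then have "e' b \<in> cl ((\<lambda>b. e' (?\<tau> b)) ` ?D)" using B(7)[OF 2(1)] 2(2) by simp
      moreover have "(\<lambda>b. e' (?\<tau> b)) ` ?D \<subseteq> e' ` {c \<in> ?Q. snd c \<subseteq> snd b}"
      proof (rule image_subsetI)
        fix c assume c: "c \<in> ?D"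
        have "snd (?\<tau> c) \<subseteq> snd b" using c 2(2) unfolding relabel_def by auto
        then show "e' (?\<tau> c) \<in> e' ` {c \<in> ?Q. snd c \<subseteq> snd b}" using c by blast
      qed
      ultimately show ?thesis using cl_mono by blast
    qed
  qed
  then show thesis by (rule that[OF _ _ _ _ pel]) (auto simp: e'B)
qed

end

text \<open>
  If \<open>Z\<close> contains one node from each residue class modulo \<open>K\<close> occurring in the label of \<open>b\<close>, then
  \<open>lift K Z b\<close> is the copy of \<open>b\<close> on the nodes of \<open>Z\<close>, since node \<open>x < K\<close> is split into \<open>x\<close> and \<open>x + K\<close>.
\<close>

definition lift :: "nat \<Rightarrow> nat set \<Rightarrow> nat \<times> nat set \<Rightarrow> nat \<times> nat set" where
  "lift K Z b = (fst b, {z \<in> Z. z mod K \<in> snd b})"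

context countable_pseudominimal
begin

text \<open>The nodes are split successively by \<open>conf_copy\<close>, node \<open>j\<close> into
  \<open>j\<close> and \<open>K + j\<close>. A set \<open>Z\<close> on which reduction modulo
  \<open>K\<close> is injective chooses at most one of the two twins, so the copy on
  \<open>Z\<close> still has the old type.\<close>

lemma conf_double:
  assumes K: "K > 0" and c: "conf {..<K} B B0 e"
  obtains B' B0' e' where "conf {..<2 * K} B' B0' e'"
    "\<forall>Z. Z \<subseteq> {..<2 * K} \<longrightarrow> inj_on (\<lambda>z. z mod K) Z \<longrightarrow>
       lift K Z ` {b \<in> B. snd b \<subseteq> (\<lambda>z. z mod K) ` Z} \<subseteq> B' \<and>
       pelem L M M ((\<lambda>b. (e b, e' (lift K Z b))) ` {b \<in> B. snd b \<subseteq> (\<lambda>z. z mod K) ` Z})"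
proof -
  \<comment> \<open>The state after \<open>j\<close> splittings. All \<open>Z\<close> are treated
    together because the induction step appeals to a different one.\<close>
  define good where "good j B' e' \<longleftrightarrow> (\<forall>Z. Z \<subseteq> {..<K + j} \<longrightarrow> inj_on (\<lambda>z. z mod K) Z \<longrightarrow>
      lift K Z ` {b \<in> B. snd b \<subseteq> (\<lambda>z. z mod K) ` Z} \<subseteq> B' \<and>
      pelem L M M ((\<lambda>b. (e b, e' (lift K Z b))) ` {b \<in> B. snd b \<subseteq> (\<lambda>z. z mod K) ` Z}))"
    for j B' and e' :: "nat \<times> nat set \<Rightarrow> 'a"
  have BX: "snd b \<subseteq> {..<K}" "e b \<in> universe M" if "b \<in> B" for b using c that by (auto simp: conf_def)
  have "\<exists>B' B0' e'. conf {..<K + j} B' B0' e' \<and> good j B' e'" if "j \<le> K" for j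
    using that
  proof (induction j)
    case 0
    have "good 0 B e"
      unfolding good_def
    proof (intro allI impI)
      fix Z assume "Z \<subseteq> {..<K + 0}" "inj_on (\<lambda>z. z mod K) Z"
      then have m: "z mod K = z" if "z \<in> Z" for z using that by auto
      then have img: "(\<lambda>z. z mod K) ` Z = Z" by simp
      have l: "lift K Z b = b" if "snd b \<subseteq> Z" for b
      proof -
        have "{z \<in> Z. z mod K \<in> snd b} = snd b" using m that by auto
        then show ?thesis by (simp add: lift_def)
      qed
      have "pelem L M M (Id_on (e ` B))" by (rule pelem_Id_on) (use BX in auto)
      then have "pelem L M M ((\<lambda>b. (e b, e (lift K Z b))) ` {b \<in> B. snd b \<subseteq> Z})"
        by (rule pelem_mono) (auto simp: l)
      moreover have "lift K Z ` {b \<in> B. snd b \<subseteq> Z} \<subseteq> B" using l by auto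
      ultimately show "lift K Z ` {b \<in> B. snd b \<subseteq> (\<lambda>z. z mod K) ` Z} \<subseteq> B \<and>
          pelem L M M ((\<lambda>b. (e b, e (lift K Z b))) ` {b \<in> B. snd b \<subseteq> (\<lambda>z. z mod K) ` Z})"
        unfolding img by simp
    qed
    then show ?case using c by (intro exI[of _ B] exI[of _ B0] exI[of _ e]) simp
  next
    case (Suc j)
    then obtain B1 B10 e1 where c1: "conf {..<K + j} B1 B10 e1" and g1: "good j B1 e1" by auto
    have j: "j \<in> {..<K + j}" "K + j \<notin> {..<K + j}" using K by auto
    obtain B2 B20 e2 where c2: "conf (insert (K + j) {..<K + j}) B2 B20 e2" "B1 \<subseteq> B2"
      "relabel j (K + j) ` B1 \<subseteq> B2" "\<forall>b \<in> B1. e2 b = e1 b"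
      "pelem L M M ((\<lambda>b. (e1 b, e2 (relabel j (K + j) b))) ` B1)"
      by (rule conf_copy[OF c1 j])
    have ins: "insert (K + j) {..<K + j} = {..<K + Suc j}" by auto
    have "good (Suc j) B2 e2"
      unfolding good_def
    proof (intro allI impI)
      fix Z assume Z: "Z \<subseteq> {..<K + Suc j}" "inj_on (\<lambda>z. z mod K) Z"
      let ?D = "{b \<in> B. snd b \<subseteq> (\<lambda>z. z mod K) ` Z}"
      show "lift K Z ` ?D \<subseteq> B2 \<and> pelem L M M ((\<lambda>b. (e b, e2 (lift K Z b))) ` ?D)"
      proof (cases "K + j \<in> Z")
        case False
        then have "Z \<subseteq> {..<K + j}" using Z(1) by (auto simp: less_Suc_eq)
        then have g: "lift K Z ` ?D \<subseteq> B1" "pelem L M M ((\<lambda>b. (e b, e1 (lift K Z b))) ` ?D)"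
          using g1 Z(2) unfolding good_def by blast+
        have "(\<lambda>b. (e b, e2 (lift K Z b))) ` ?D = (\<lambda>b. (e b, e1 (lift K Z b))) ` ?D"
          by (rule image_cong[OF refl]) (use g(1) c2(4) in auto)
        then show ?thesis using g c2(2) by auto
      next
        case True
        have jm: "(K + j) mod K = j" "j mod K = j" using Suc.prems by simp_all
        have jZ: "j \<notin> Z" using inj_onD[OF Z(2) _ True, of j] jm K by auto
        \<comment> \<open>Trading the newest node for its twin gives a set from the previous stage;
          the lift to \<open>Z\<close> is the lift to this set followed by the last copying.\<close>
        let ?Z = "insert j (Z - {K + j})"
        have im: "(\<lambda>z. z mod K) ` ?Z = (\<lambda>z. z mod K) ` Z"
        proof -
          have "(\<lambda>z. z mod K) ` ?Z = insert ((K + j) mod K) ((\<lambda>z. z mod K) ` (Z - {K + j}))"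
            unfolding image_insert jm ..
          also have "\<dots> = (\<lambda>z. z mod K) ` insert (K + j) (Z - {K + j})" by (rule image_insert[symmetric])
          also have "insert (K + j) (Z - {K + j}) = Z" using True by (rule insert_Diff)
          finally show ?thesis .
        qed
        have "inj_on (\<lambda>z. z mod K) ?Z"
        proof (rule inj_onI)
          have ne: "z mod K \<noteq> j" if "z \<in> Z - {K + j}" for z
            using inj_onD[OF Z(2) _ _ True, of z] that jm by auto
          fix x y assume "x \<in> ?Z" "y \<in> ?Z" "x mod K = y mod K"
          then show "x = y" using ne inj_onD[OF Z(2), of x y] jm by (metis DiffD1 insertE)
        qed
        moreover have "?Z \<subseteq> {..<K + j}" using Z(1) K by (auto simp: less_Suc_eq)
        ultimately have g: "lift K ?Z ` ?D \<subseteq> B1" "pelem L M M ((\<lambda>b. (e b, e1 (lift K ?Z b))) ` ?D)"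
          using g1 unfolding good_def im[symmetric] by blast+
        have l: "lift K Z b = relabel j (K + j) (lift K ?Z b)" for b
        proof -
          have "{z \<in> Z. z mod K \<in> snd b} = (id(j := K + j)) ` {z \<in> ?Z. z mod K \<in> snd b}" (is "?l = ?r")
          proof
            show "?l \<subseteq> ?r"
            proof
              fix z assume z: "z \<in> ?l"
              show "z \<in> ?r"
              proof (cases "z = K + j")
                case True
                then show ?thesis using z jm by (intro image_eqI[of _ _ j]) auto
              next
                case False
                then show ?thesis using z jZ by (intro image_eqI[of _ _ z]) auto
              qed
            qed
            show "?r \<subseteq> ?l" using True jm by auto
          qed
          then show ?thesis by (simp add: lift_def relabel_def)
        qed
        have "lift K Z ` ?D \<subseteq> B2" using g(1) c2(3) unfolding l by blast
        moreover have "pelem L M M ((\<lambda>b. (e b, e2 (lift K Z b))) ` ?D)"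
        proof (rule pelem_mono[OF pelem_relcomp[OF g(2) c2(5)]])
          show "(\<lambda>b. (e b, e2 (lift K Z b))) ` ?D
            \<subseteq> (\<lambda>b. (e b, e1 (lift K ?Z b))) ` ?D O (\<lambda>b. (e1 b, e2 (relabel j (K + j) b))) ` B1"
          proof (rule image_subsetI)
            fix b assume b: "b \<in> ?D"
            have "(e1 (lift K ?Z b), e2 (relabel j (K + j) (lift K ?Z b))) \<in> (\<lambda>b. (e1 b, e2 (relabel j (K + j) b))) ` B1"
              by (rule image_eqI[OF refl]) (use g(1) b in auto)
            moreover have "(e b, e1 (lift K ?Z b)) \<in> (\<lambda>b. (e b, e1 (lift K ?Z b))) ` ?D"
              by (rule imageI[OF b])
            ultimately show "(e b, e2 (lift K Z b))
              \<in> (\<lambda>b. (e b, e1 (lift K ?Z b))) ` ?D O (\<lambda>b. (e1 b, e2 (relabel j (K + j) b))) ` B1"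
              unfolding l by (rule relcompI[rotated])
          qed
        qed
        ultimately show ?thesis ..
      qed
    qed
    then show ?case using c2(1) unfolding ins by blast
  qed
  from this[OF order_refl] obtain B' B0' e' where c': "conf {..<2 * K} B' B0' e'" and g': "good K B' e'"
    by (auto simp: mult_2)
  show thesis
    by (rule that[OF c']) (use g' in \<open>simp only: good_def mult_2\<close>)
qed

text \<open>The new name has a fresh index and the full label \<open>X\<close>: the witness may
  depend on every base element, and all base labels lie inside \<open>X\<close>.\<close>

lemma conf_witness:
  assumes c: "conf X B B0 e" and \<phi>: "fm_of L \<phi>" "v ` fv (Exists x \<phi>) \<subseteq> B" "sat M (e \<circ> v) (Exists x \<phi>)"
  obtains B' B0' e' b where "conf X B' B0' e'" "B \<subseteq> B'" "\<forall>c \<in> B. e' c = e c"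
    "b \<in> B'" "sat M (e' \<circ> v(x := b)) \<phi>"
proof -
  have B: "finite B" "B0 \<subseteq> B" "\<And>b. b \<in> B \<Longrightarrow> snd b \<subseteq> X" "e ` B \<subseteq> universe M" "inj_on e B0"
    "indep (e ` B0)" "\<And>b. b \<in> B \<Longrightarrow> e b \<in> cl (e ` {c \<in> B0. snd c \<subseteq> snd b})" "\<And>x. x \<in> X \<Longrightarrow> (0, {x}) \<in> B0"
    using c unfolding conf_def by blast+
  obtain y where y: "y \<in> universe M" "sat M ((e \<circ> v)(x := y)) \<phi>" using \<phi>(3) by auto
  obtain i where i: "i \<notin> fst ` B" using ex_new_if_finite[OF infinite_UNIV_nat finite_imageI[OF B(1)]] by blast
  define b where "b = (i, X)"
  have b: "b \<notin> B" using i by (force simp: b_def)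
  define e' where "e' = e(b := y)"
  have e'b: "e' b = y" by (simp add: e'_def)
  have e'c: "e' c = e c" if "c \<in> B" for c using that b by (auto simp: e'_def)
  \<comment> \<open>A witness outside the closure of the configuration cannot be spanned by the old
    base, so it joins the base.\<close>
  let ?C = "if y \<in> cl (e ` B) then B0 else insert b B0"
  have eB: "e' ` D = e ` D" if "D \<subseteq> B" for D
    by (rule image_cong[OF refl]) (use that e'c in blast)
  have span: "cl (e ` B) \<subseteq> cl (e ` B0)" by (rule pcl_trans[OF conf_span[OF c]])
  have BX: "{c \<in> B0. snd c \<subseteq> X} = B0" using B(2,3) by auto
  have bB0: "b \<notin> B0" using b B(2) by blast
  have "conf X (insert b B) ?C e'"
    unfolding conf_def
  proof (intro conjI ballI)
    show "finite (insert b B)" "?C \<subseteq> insert b B" using B(1,2) by auto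
    show "snd c \<subseteq> X" if "c \<in> insert b B" for c
      using that B(3)[of c] unfolding b_def by (metis insertE order_refl snd_conv)
    show "e' ` insert b B \<subseteq> universe M" using B(4) y eB[OF order_refl] e'b by simp
    show "inj_on e' ?C"
    proof (cases "y \<in> cl (e ` B)")
      case True
      then show ?thesis using inj_on_cong[of B0 e' e] B(5) e'c subsetD[OF B(2)] by simp
    next
      case False
      then have "y \<notin> e ` B0" using pcl_superset[OF B(4), of L] B(2) by blast
      moreover have "inj_on e' B0" using inj_on_cong[of B0 e' e] B(5) e'c subsetD[OF B(2)] by simp
      ultimately show ?thesis using False eB[OF B(2)] e'b bB0 by simp
    qed
    show "indep (e' ` ?C)"
    proof (cases "y \<in> cl (e ` B)")
      case True
      then show ?thesis using eB[OF B(2)] B(6) by simp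
    next
      case False
      have "e' ` ?C = insert y (e ` B0)" using False eB[OF B(2)] e'b by simp
      moreover have "y \<notin> cl (e ` B0)" using False cl_mono[of y "e ` B0" "e ` B"] B(2) by blast
      ultimately show ?thesis using indep_insert[OF B(6) y(1)] by simp
    qed
    show "(0, {z}) \<in> ?C" if "z \<in> X" for z using B(8)[OF that] by simp
    fix c assume "c \<in> insert b B"
    then consider "c \<in> B" | "c = b" by blast
    then show "e' c \<in> cl (e' ` {d \<in> ?C. snd d \<subseteq> snd c})"
    proof cases
      case 1
      have "e ` {d \<in> B0. snd d \<subseteq> snd c} = e' ` {d \<in> B0. snd d \<subseteq> snd c}"
        by (rule eB[symmetric]) (use B(2) in blast)
      also have "\<dots> \<subseteq> e' ` {d \<in> ?C. snd d \<subseteq> snd c}" by (rule image_mono) auto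
      finally have "e c \<in> cl (e' ` {d \<in> ?C. snd d \<subseteq> snd c})" using cl_mono[OF B(7)[OF 1]] by blast
      moreover have "e' c = e c" by (rule e'c[OF 1])
      ultimately show ?thesis by simp
    next
      case 2
      show ?thesis
      proof (cases "y \<in> cl (e ` B)")
        case True
        then have "{d \<in> ?C. snd d \<subseteq> snd c} = B0" using 2 BX by (simp add: b_def)
        then show ?thesis using subsetD[OF span True] eB[OF B(2)] 2 e'b by simp
      next
        case False
        let ?D = "e' ` {d \<in> ?C. snd d \<subseteq> snd c}"
        have "b \<in> {d \<in> ?C. snd d \<subseteq> snd c}" using False 2 by simp
        then have "e' b \<in> ?D" by (rule imageI)
        moreover have "?D \<subseteq> universe M"
        proof -
          have "?D \<subseteq> e' ` insert b B" by (rule image_mono) (use B(2) in auto)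
          also have "\<dots> = insert y (e ` B)" using eB[OF order_refl] e'b by simp
          finally show ?thesis using B(4) y(1) by blast
        qed
        ultimately show ?thesis using pcl_superset[of ?D M L] 2 by blast
      qed
    qed
  qed
  moreover have ev: "e' (v i) = e (v i)" if "i \<in> fv \<phi>" "i \<noteq> x" for i
    by (rule e'c) (use \<phi>(2) that in auto)
  have "sat M (e' \<circ> v(x := b)) \<phi>"
    by (rule iffD1[OF sat_cong y(2)]) (simp add: ev e'b)
  ultimately show thesis using that[of "insert b B" ?C e' b] e'c by blast
qed

text \<open>Assignments matter only on the free variables, where they form the finite set
  \<open>PiE ?F (\<lambda>_. B)\<close>. Values of earlier names never change, so witnesses already
  found survive the later extensions.\<close>

lemma conf_witnesses:
  assumes c: "conf X B B0 e" and \<phi>: "fm_of L \<phi>"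
  obtains B' B0' e' where "conf X B' B0' e'" "B \<subseteq> B'" "\<forall>c \<in> B. e' c = e c"
    "\<forall>v. v ` fv (Exists x \<phi>) \<subseteq> B \<longrightarrow> sat M (e \<circ> v) (Exists x \<phi>) \<longrightarrow> (\<exists>b \<in> B'. sat M (e' \<circ> v(x := b)) \<phi>)"
proof -
  let ?F = "fv (Exists x \<phi>)"
  let ?V = "{v \<in> PiE ?F (\<lambda>_. B). sat M (e \<circ> v) (Exists x \<phi>)}"
  have finF: "finite ?F" by (rule finite_fv)
  have "finite B" using c by (simp add: conf_def)
  then have "finite ?V" using finite_PiE[OF finF, of "\<lambda>_. B"] by simp
  then have "\<exists>B' B0' e'. conf X B' B0' e' \<and> B \<subseteq> B' \<and> (\<forall>c \<in> B. e' c = e c) \<and>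
    (\<forall>v \<in> ?V. \<exists>b \<in> B'. sat M (e' \<circ> v(x := b)) \<phi>)"
  proof (rule finite_subset_induct'[OF _ order_refl, where P = "\<lambda>W. \<exists>B' B0' e'. conf X B' B0' e' \<and> B \<subseteq> B' \<and>
      (\<forall>c \<in> B. e' c = e c) \<and> (\<forall>v \<in> W. \<exists>b \<in> B'. sat M (e' \<circ> v(x := b)) \<phi>)"])
    show "\<exists>B' B0' e'. conf X B' B0' e' \<and> B \<subseteq> B' \<and> (\<forall>c \<in> B. e' c = e c) \<and>
        (\<forall>v \<in> {}. \<exists>b \<in> B'. sat M (e' \<circ> v(x := b)) \<phi>)"
      using c by (intro exI[of _ B] exI[of _ B0] exI[of _ e]) simp
  next
    fix v W assume v: "v \<in> ?V" and W: "W \<subseteq> ?V" and "\<exists>B' B0' e'. conf X B' B0' e' \<and> B \<subseteq> B' \<and>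
      (\<forall>c \<in> B. e' c = e c) \<and> (\<forall>v \<in> W. \<exists>b \<in> B'. sat M (e' \<circ> v(x := b)) \<phi>)"
    then obtain B1 B10 e1 where 1: "conf X B1 B10 e1" "B \<subseteq> B1" "\<And>c. c \<in> B \<Longrightarrow> e1 c = e c"
      "\<And>v. v \<in> W \<Longrightarrow> \<exists>b \<in> B1. sat M (e1 \<circ> v(x := b)) \<phi>" by blast
    have vB: "v ` ?F \<subseteq> B" using v by (auto simp: PiE_def)
    have "sat M (e \<circ> v) (Exists x \<phi>)" using v by blast
    then have v1: "sat M (e1 \<circ> v) (Exists x \<phi>)"
    proof (rule iffD1[OF sat_cong, rotated])
      show "(e \<circ> v) i = (e1 \<circ> v) i" if "i \<in> ?F" for i
        using 1(3)[of "v i"] vB that by auto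
    qed
    have vB1: "v ` ?F \<subseteq> B1" using vB 1(2) by (rule order_trans)
    obtain B2 B20 e2 b where 2: "conf X B2 B20 e2" "B1 \<subseteq> B2" "\<forall>c \<in> B1. e2 c = e1 c"
      "b \<in> B2" "sat M (e2 \<circ> v(x := b)) \<phi>"
      by (rule conf_witness[OF 1(1) \<phi> vB1 v1])
    have "\<exists>b \<in> B2. sat M (e2 \<circ> w(x := b)) \<phi>" if w: "w \<in> W" for w
    proof -
      obtain d where d: "d \<in> B1" "sat M (e1 \<circ> w(x := d)) \<phi>" using 1(4)[OF w] by blast
      have wB: "w i \<in> B" if "i \<in> ?F" for i using w W that by (auto simp: PiE_def)
      have "(e1 \<circ> w(x := d)) i = (e2 \<circ> w(x := d)) i" if "i \<in> fv \<phi>" for i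
        using that d(1) bspec[OF 2(3), of "w i"] bspec[OF 2(3), of d] subsetD[OF 1(2), of "w i"] wB[of i]
        by (cases "i = x") simp_all
      then have "sat M (e2 \<circ> w(x := d)) \<phi>" by (rule iffD1[OF sat_cong d(2)])
      then show ?thesis using d(1) 2(2) by blast
    qed
    moreover have "\<forall>c \<in> B. e2 c = e c" using 1(2,3) 2(3) by (metis subsetD)
    moreover have "B \<subseteq> B2" using 1(2) 2(2) by (rule order_trans)
    ultimately show "\<exists>B' B0' e'. conf X B' B0' e' \<and> B \<subseteq> B' \<and>
      (\<forall>c \<in> B. e' c = e c) \<and> (\<forall>v \<in> insert v W. \<exists>b \<in> B'. sat M (e' \<circ> v(x := b)) \<phi>)"
      using 2 by blast
  qed
  then obtain B' B0' e' where *: "conf X B' B0' e'" "B \<subseteq> B'" "\<And>c. c \<in> B \<Longrightarrow> e' c = e c"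
    "\<And>v. v \<in> ?V \<Longrightarrow> \<exists>b \<in> B'. sat M (e' \<circ> v(x := b)) \<phi>" by blast
  have "\<exists>b \<in> B'. sat M (e' \<circ> v(x := b)) \<phi>"
    if v: "v ` ?F \<subseteq> B" "sat M (e \<circ> v) (Exists x \<phi>)" for v
  proof -
    let ?v = "restrict v ?F"
    have "sat M (e \<circ> ?v) (Exists x \<phi>)" by (rule iffD1[OF sat_cong v(2)]) simp
    moreover have "?v \<in> PiE ?F (\<lambda>_. B)" using v(1) by auto
    ultimately obtain b where b: "b \<in> B'" "sat M (e' \<circ> ?v(x := b)) \<phi>" using *(4) by blast
    have "sat M (e' \<circ> v(x := b)) \<phi>" by (rule iffD1[OF sat_cong b(2)]) auto
    then show ?thesis using b(1) by blast
  qed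
  then show thesis using that *(1-3) by blast
qed

end

section \<open>Limits of eventually coherent sequences\<close>

text \<open>A form of the theorem of Los for the filter of tails. This filter is not maximal, so
  negation is the critical case; \<open>stab\<close> repairs it by making each formula eventually
  constant in truth value. \<open>wit\<close> serves the existential quantifier and also supplies
  the values of the functions.\<close>

lemma limit_model:
  fixes M :: "('a, 'f, 'r) struct" and S :: "(nat \<Rightarrow> 'a) set"
  assumes M: "structure_of L M" and ne: "S \<noteq> {}"
    and stab: "\<And>G. finite G \<Longrightarrow> G \<subseteq> S \<Longrightarrow> \<exists>m. \<forall>n \<ge> m. pelem L M M ((\<lambda>s. (s m, s n)) ` G)"
    and wit: "\<And>\<phi> x v. fm_of L \<phi> \<Longrightarrow> v ` fv (Exists x \<phi>) \<subseteq> S \<Longrightarrow>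
      (\<forall>\<^sub>F n in sequentially. sat M (\<lambda>i. v i n) (Exists x \<phi>)) \<Longrightarrow>
      \<exists>s \<in> S. \<forall>\<^sub>F n in sequentially. sat M ((\<lambda>i. v i n)(x := s n)) \<phi>"
  obtains N :: "(nat \<Rightarrow> 'a, 'f, 'r) struct" and r where "structure_of L N" "universe N \<subseteq> S"
    "\<forall>s \<in> S. r s \<in> universe N \<and> (\<forall>\<^sub>F n in sequentially. s n = r s n)"
    "\<forall>\<phi> v. fm_of L \<phi> \<longrightarrow> v ` fv \<phi> \<subseteq> universe N \<longrightarrow>
       sat N v \<phi> = (\<forall>\<^sub>F n in sequentially. sat M (\<lambda>i. v i n) \<phi>)"
proof -
  have in_univ: "\<forall>\<^sub>F n in sequentially. \<forall>s \<in> G. s n \<in> universe M" if G: "finite G" "G \<subseteq> S" for G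
  proof -
    obtain m where m: "\<And>n. n \<ge> m \<Longrightarrow> pelem L M M ((\<lambda>s. (s m, s n)) ` G)" using stab[OF G] by blast
    have "\<forall>s \<in> G. s n \<in> universe M" if "n \<ge> m" for n
      using m[OF that] unfolding pelem_def by blast
    then show ?thesis unfolding eventually_sequentially by blast
  qed
  have decided: "(\<forall>\<^sub>F n in sequentially. sat M (\<lambda>i. v i n) \<phi>) \<or> (\<forall>\<^sub>F n in sequentially. \<not> sat M (\<lambda>i. v i n) \<phi>)"
    if \<phi>: "fm_of L \<phi>" "v ` fv \<phi> \<subseteq> S" for \<phi> v
  proof -
    obtain m where m: "\<And>n. n \<ge> m \<Longrightarrow> pelem L M M ((\<lambda>s. (s m, s n)) ` v ` fv \<phi>)"
      using stab[OF finite_imageI[OF finite_fv] \<phi>(2)] by blast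
    have "sat M (\<lambda>i. v i m) \<phi> = sat M (\<lambda>i. v i n) \<phi>" if "n \<ge> m" for n
      by (rule pelem_sat[OF m[OF that] \<phi>(1)]) blast
    then show ?thesis unfolding eventually_sequentially by metis
  qed
  \<comment> \<open>Representatives replace equivalence classes, which keeps the universe inside
    \<open>S\<close>. The choice depends only on the class, so in \<open>U\<close> eventual equality
    is equality.\<close>
  define r where "r s = (SOME t. t \<in> S \<and> (\<forall>\<^sub>F n in sequentially. s n = t n))" for s
  define U where "U = r ` S"
  have r: "r s \<in> S \<and> (\<forall>\<^sub>F n in sequentially. s n = r s n)" if "s \<in> S" for s
    unfolding r_def by (rule someI[of _ s]) (use that in simp)
  have r_eq: "r s = r t" if "\<forall>\<^sub>F n in sequentially. s n = t n" for s t
  proof -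
    have "(\<forall>\<^sub>F n in sequentially. s n = q n) = (\<forall>\<^sub>F n in sequentially. t n = q n)" for q
      by (rule eventually_subst) (use that in \<open>auto elim: eventually_mono\<close>)
    then show ?thesis by (simp add: r_def)
  qed
  have US: "U \<subseteq> S" using r by (auto simp: U_def)
  have U_eq: "s = t" if st: "s \<in> U" "t \<in> U" and ev: "\<forall>\<^sub>F n in sequentially. s n = t n" for s t
  proof -
    obtain s' t' where s': "s' \<in> S" "s = r s'" and t': "t' \<in> S" "t = r t'" using st by (auto simp: U_def)
    have "\<forall>\<^sub>F n in sequentially. s' n = t' n"
      using ev r[OF s'(1), THEN conjunct2] r[OF t'(1), THEN conjunct2] unfolding s'(2) t'(2)
      by eventually_elim simp
    then show ?thesis using r_eq s'(2) t'(2) by simp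
  qed
  define N where "N = \<lparr>universe = U,
    fn = \<lambda>f xs. SOME t. t \<in> U \<and> (\<forall>\<^sub>F n in sequentially. fn M f (map (\<lambda>s. s n) xs) = t n),
    rel = \<lambda>q xs. \<forall>\<^sub>F n in sequentially. rel M q (map (\<lambda>s. s n) xs)\<rparr>"
  have N: "universe N = U" "rel N q xs = (\<forall>\<^sub>F n in sequentially. rel M q (map (\<lambda>s. s n) xs))" for q xs
    by (simp_all add: N_def)
  have fn: "fn N f xs \<in> U \<and> (\<forall>\<^sub>F n in sequentially. fn M f (map (\<lambda>s. s n) xs) = fn N f xs n)"
    if f: "f \<in> funs L" "xs \<in> lists U" "length xs = farity L f" for f xs
  proof -
    let ?k = "length xs"
    \<comment> \<open>The sequence of values of \<open>f\<close> need not lie in \<open>S\<close>;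
      \<open>wit\<close> for this formula gives a member of \<open>S\<close> that is eventually
      equal to it.\<close>
    let ?\<phi> = "Eq (Var ?k) (Fn f (map Var [0..<?k]))"
    have nth: "map ((\<lambda>i. (xs ! i) n)(?k := y)) [0..<?k] = map (\<lambda>s. s n) xs" for n y
      by (rule nth_equalityI) auto
    have sat_iff: "sat M ((\<lambda>i. (xs ! i) n)(?k := y)) ?\<phi> \<longleftrightarrow> y = fn M f (map (\<lambda>s. s n) xs)" for n y
    proof -
      have "map (eval M w) (map Var [0..<?k]) = map w [0..<?k]" for w by simp
      then show ?thesis by (simp only: sat.simps eval.simps nth fun_upd_same)
    qed
    have xsS: "finite (set xs)" "set xs \<subseteq> S" using f(2) US by auto
    have "\<forall>\<^sub>F n in sequentially. sat M (\<lambda>i. (xs ! i) n) (Exists ?k ?\<phi>)"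
      using in_univ[OF xsS]
    proof eventually_elim
      case (elim n)
      then have "map (\<lambda>s. s n) xs \<in> lists (universe M)" by auto
      then have "fn M f (map (\<lambda>s. s n) xs) \<in> universe M" using M f by (auto simp: structure_of_def)
      then show ?case unfolding sat.simps(5) sat_iff by blast
    qed
    moreover have "fm_of L ?\<phi>" using f by simp
    moreover have "nth xs ` fv (Exists ?k ?\<phi>) \<subseteq> S" using xsS(2) by auto
    ultimately obtain s where s: "s \<in> S" "\<forall>\<^sub>F n in sequentially. sat M ((\<lambda>i. (xs ! i) n)(?k := s n)) ?\<phi>"
      using wit by blast
    have "\<forall>\<^sub>F n in sequentially. fn M f (map (\<lambda>s. s n) xs) = r s n"
      using s(2) r[OF s(1), THEN conjunct2] unfolding sat_iff by eventually_elim simp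
    moreover have "r s \<in> U" using s(1) by (simp add: U_def)
    ultimately have "\<exists>t. t \<in> U \<and> (\<forall>\<^sub>F n in sequentially. fn M f (map (\<lambda>s. s n) xs) = t n)" by blast
    then show ?thesis unfolding N_def struct.simps by (rule someI_ex)
  qed
  have eval: "eval N v t \<in> U \<and> (\<forall>\<^sub>F n in sequentially. eval N v t n = eval M (\<lambda>i. v i n) t)"
    if "tm_of L t" "v ` fv_tm t \<subseteq> U" for t v
    using that
  proof (induction t)
    case (Fn f ts)
    have IH: "eval N v t \<in> U" "\<forall>\<^sub>F n in sequentially. eval N v t n = eval M (\<lambda>i. v i n) t" if "t \<in> set ts" for t
      using Fn.IH[OF that] Fn.prems that by auto
    have f: "f \<in> funs L" "map (eval N v) ts \<in> lists U" "length (map (eval N v) ts) = farity L f"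
      using Fn.prems IH(1) by auto
    have "\<forall>\<^sub>F n in sequentially. \<forall>t \<in> set ts. eval N v t n = eval M (\<lambda>i. v i n) t"
      by (rule eventually_ball_finite) (use IH(2) in auto)
    then have "\<forall>\<^sub>F n in sequentially. fn N f (map (eval N v) ts) n = fn M f (map (eval M (\<lambda>i. v i n)) ts)"
      using fn[OF f, THEN conjunct2]
    proof eventually_elim
      case (elim n)
      have "map (\<lambda>s. s n) (map (eval N v) ts) = map (eval M (\<lambda>i. v i n)) ts" using elim(1) by simp
      then show ?case using elim(2) by (simp only:)
    qed
    then show ?case using fn[OF f] by simp
  qed auto
  have sat: "sat N v \<phi> = (\<forall>\<^sub>F n in sequentially. sat M (\<lambda>i. v i n) \<phi>)"
    if "fm_of L \<phi>" "v ` fv \<phi> \<subseteq> U" for \<phi> v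
    using that
  proof (induction \<phi> arbitrary: v)
    case (Eq s t)
    have s: "eval N v s \<in> U" "\<forall>\<^sub>F n in sequentially. eval N v s n = eval M (\<lambda>i. v i n) s"
      and t: "eval N v t \<in> U" "\<forall>\<^sub>F n in sequentially. eval N v t n = eval M (\<lambda>i. v i n) t"
      using eval[of s v] eval[of t v] Eq.prems by auto
    have "(\<forall>\<^sub>F n in sequentially. sat M (\<lambda>i. v i n) (Eq s t)) = (\<forall>\<^sub>F n in sequentially. eval N v s n = eval N v t n)"
      by (rule eventually_subst) (use s(2) t(2) in \<open>eventually_elim, simp\<close>)
    also have "\<dots> = (eval N v s = eval N v t)" using U_eq[OF s(1) t(1)] by auto
    finally show ?case by simp
  next
    case (Rel q ts)
    have "\<forall>\<^sub>F n in sequentially. \<forall>t \<in> set ts. eval N v t n = eval M (\<lambda>i. v i n) t"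
      by (rule eventually_ball_finite) (use Rel.prems in \<open>auto intro!: eval[THEN conjunct2]\<close>)
    then have "(\<forall>\<^sub>F n in sequentially. rel M q (map (\<lambda>s. s n) (map (eval N v) ts))) =
        (\<forall>\<^sub>F n in sequentially. sat M (\<lambda>i. v i n) (Rel q ts))"
    proof (intro eventually_subst, eventually_elim)
      case (elim n)
      have "map (\<lambda>s. s n) (map (eval N v) ts) = map (eval M (\<lambda>i. v i n)) ts" using elim by simp
      then show ?case by (simp only: sat.simps)
    qed
    then show ?case by (simp only: sat.simps N)
  next
    case (Neg \<phi>)
    have \<phi>: "fm_of L \<phi>" "v ` fv \<phi> \<subseteq> U" "v ` fv \<phi> \<subseteq> S" using Neg.prems US by auto
    have "\<not> ((\<forall>\<^sub>F n in sequentially. sat M (\<lambda>i. v i n) \<phi>) \<and> (\<forall>\<^sub>F n in sequentially. \<not> sat M (\<lambda>i. v i n) \<phi>))"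
      unfolding eventually_conj_iff[symmetric] by simp
    then show ?case using decided[OF \<phi>(1,3)] Neg.IH[OF \<phi>(1,2)] by auto
  next
    case (Conj \<phi> \<psi>)
    then show ?case by (simp add: eventually_conj_iff image_Un)
  next
    case (Exists x \<phi>)
    have upd: "(\<lambda>i. (v(x := s)) i n) = (\<lambda>i. v i n)(x := s n)" for s n by auto
    have IH: "sat N (v(x := s)) \<phi> = (\<forall>\<^sub>F n in sequentially. sat M ((\<lambda>i. v i n)(x := s n)) \<phi>)" if "s \<in> U" for s
      unfolding upd[symmetric] by (rule Exists.IH) (use Exists.prems that in auto)
    show ?case
    proof
      assume "sat N v (Exists x \<phi>)"
      then obtain s where s: "s \<in> U" "\<forall>\<^sub>F n in sequentially. sat M ((\<lambda>i. v i n)(x := s n)) \<phi>"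
        using IH by (auto simp: N)
      have "\<forall>\<^sub>F n in sequentially. \<forall>t \<in> {s}. t n \<in> universe M"
        by (rule in_univ) (use s(1) US in auto)
      with s(2) show "\<forall>\<^sub>F n in sequentially. sat M (\<lambda>i. v i n) (Exists x \<phi>)"
        by eventually_elim auto
    next
      assume ev: "\<forall>\<^sub>F n in sequentially. sat M (\<lambda>i. v i n) (Exists x \<phi>)"
      have "v ` fv (Exists x \<phi>) \<subseteq> S" using Exists.prems(2) US by (rule order_trans)
      then obtain s where s: "s \<in> S" "\<forall>\<^sub>F n in sequentially. sat M ((\<lambda>i. v i n)(x := s n)) \<phi>"
        using wit[OF _ _ ev] Exists.prems(1) by auto
      have "\<forall>\<^sub>F n in sequentially. sat M ((\<lambda>i. v i n)(x := r s n)) \<phi>"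
        using s(2) r[OF s(1), THEN conjunct2] by eventually_elim simp
      moreover have "r s \<in> U" using s(1) by (simp add: U_def)
      ultimately show "sat N v (Exists x \<phi>)" using IH by (auto simp: N)
    qed
  qed
  have "structure_of L N" using ne fn by (auto simp: structure_of_def N U_def)
  moreover have "\<forall>s \<in> S. r s \<in> universe N \<and> (\<forall>\<^sub>F n in sequentially. s n = r s n)"
    using r by (simp add: N U_def)
  moreover have "\<forall>\<phi> v. fm_of L \<phi> \<longrightarrow> v ` fv \<phi> \<subseteq> universe N \<longrightarrow>
       sat N v \<phi> = (\<forall>\<^sub>F n in sequentially. sat M (\<lambda>i. v i n) \<phi>)"
    unfolding N(1) by (intro allI impI sat)
  moreover have "universe N \<subseteq> S" unfolding N(1) by (rule US)
  ultimately show thesis by (intro that)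
qed

section \<open>The perfect tree of approximations\<close>

text \<open>The node of the branch at level \<open>n\<close>, read as a binary number with the
  earliest bit least significant. The successors of \<open>x\<close> are thus \<open>x\<close> and
  \<open>x + 2 ^ n\<close>, as \<open>conf_double\<close> produces them for
  \<open>K = 2 ^ n\<close>.\<close>

primrec trunc :: "nat \<Rightarrow> (nat \<Rightarrow> bool) \<Rightarrow> nat" where
  "trunc 0 \<sigma> = 0"
| "trunc (Suc n) \<sigma> = trunc n \<sigma> + (if \<sigma> n then 2 ^ n else 0)"

lemma trunc_less: "trunc n \<sigma> < 2 ^ n"
  by (induction n) auto

lemma trunc_Suc_mod: "trunc (Suc n) \<sigma> mod 2 ^ n = trunc n \<sigma>"
  using trunc_less[of n \<sigma>] by simp

lemma trunc_bit:
  assumes "z < 2 ^ n" shows "trunc n (bit z) = z"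
proof -
  have "trunc n (bit z) = take_bit n z"
    by (induction n) (simp_all add: take_bit_Suc_from_most)
  then show ?thesis using assms by (simp add: take_bit_nat_eq_self)
qed

lemma trunc_eqD: "trunc n \<sigma> = trunc n \<tau> \<Longrightarrow> k < n \<Longrightarrow> \<sigma> k = \<tau> k"
proof (induction n)
  case (Suc n)
  have eq: "trunc n \<sigma> = trunc n \<tau>" using trunc_Suc_mod[of n] Suc.prems(1) by metis
  then have "\<sigma> n = \<tau> n" using Suc.prems(1) by (auto split: if_splits)
  then show ?case using Suc.IH[OF eq] Suc.prems(2) by (auto simp: less_Suc_eq)
qed simp

lemma eventually_trunc_neq: "\<sigma> \<noteq> \<tau> \<Longrightarrow> \<forall>\<^sub>F n in sequentially. trunc n \<sigma> \<noteq> trunc n \<tau>"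
proof -
  assume "\<sigma> \<noteq> \<tau>"
  then obtain k where "\<sigma> k \<noteq> \<tau> k" by blast
  then have "trunc n \<sigma> \<noteq> trunc n \<tau>" if "n \<ge> Suc k" for n using trunc_eqD[of n \<sigma> \<tau> k] that by auto
  then show ?thesis unfolding eventually_sequentially by blast
qed

lemma eventually_inj_on_trunc:
  assumes "finite F" shows "\<forall>\<^sub>F n in sequentially. inj_on (trunc n) F"
proof -
  have "\<forall>\<^sub>F n in sequentially. \<forall>p \<in> F \<times> F. trunc n (fst p) = trunc n (snd p) \<longrightarrow> fst p = snd p"
  proof (rule eventually_ball_finite)
    show "\<forall>p \<in> F \<times> F. \<forall>\<^sub>F n in sequentially. trunc n (fst p) = trunc n (snd p) \<longrightarrow> fst p = snd p"
    proof
      fix p :: "(nat \<Rightarrow> bool) \<times> (nat \<Rightarrow> bool)"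
      show "\<forall>\<^sub>F n in sequentially. trunc n (fst p) = trunc n (snd p) \<longrightarrow> fst p = snd p"
      proof (cases "fst p = snd p")
        case False
        then show ?thesis by (rule eventually_mono[OF eventually_trunc_neq]) simp
      qed simp
    qed
  qed (use assms in simp)
  then show ?thesis by eventually_elim (auto simp: inj_on_def)
qed

text \<open>Names of the limit carry finite sets of branches as labels; cutting the branches at
  level \<open>n\<close> gives a name of stage \<open>n\<close>.\<close>

definition at :: "nat \<Rightarrow> nat \<times> (nat \<Rightarrow> bool) set \<Rightarrow> nat \<times> nat set" where
  "at n g = (fst g, trunc n ` snd g)"

text \<open>A branch of \<open>F\<close> outside the label shares no node of level \<open>n\<close>
  with one inside, so \<open>lift\<close> selects exactly the successors along the label.\<close>

lemma at_Suc:
  assumes "inj_on (trunc n) F" "snd g \<subseteq> F"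
  shows "at (Suc n) g = lift (2 ^ n) (trunc (Suc n) ` F) (at n g)"
proof -
  have "{z \<in> trunc (Suc n) ` F. z mod 2 ^ n \<in> trunc n ` snd g} = trunc (Suc n) ` {\<sigma> \<in> F. trunc n \<sigma> \<in> trunc n ` snd g}"
    unfolding trunc_Suc_mod[of n, symmetric] by blast
  also have "{\<sigma> \<in> F. trunc n \<sigma> \<in> trunc n ` snd g} = snd g"
    using assms inj_on_image_mem_iff[OF assms(1) _ assms(2)] by auto
  finally show ?thesis by (simp add: at_def lift_def del: trunc.simps)
qed

context countable_pseudominimal
begin

text \<open>\<open>P\<close> is the configuration between doubling and adding witnesses, and only
  its tuples are served. Adding witnesses leaves the values on \<open>P\<close> unchanged, so the
  conclusion of doubling may be stated with the final assignment.\<close>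

lemma conf_step:
  assumes c: "conf {..<2 ^ n} B B0 e" and \<phi>: "fm_of L \<phi>"
  obtains P B' B0' e' where "conf {..<2 ^ Suc n} B' B0' e'" "P \<subseteq> B'"
    "\<forall>Z. Z \<subseteq> {..<2 ^ Suc n} \<longrightarrow> inj_on (\<lambda>z. z mod 2 ^ n) Z \<longrightarrow>
       lift (2 ^ n) Z ` {b \<in> B. snd b \<subseteq> (\<lambda>z. z mod 2 ^ n) ` Z} \<subseteq> P \<and>
       pelem L M M ((\<lambda>b. (e b, e' (lift (2 ^ n) Z b))) ` {b \<in> B. snd b \<subseteq> (\<lambda>z. z mod 2 ^ n) ` Z})"
    "\<forall>v. v ` fv (Exists x \<phi>) \<subseteq> P \<longrightarrow> sat M (e' \<circ> v) (Exists x \<phi>) \<longrightarrow> (\<exists>b \<in> B'. sat M (e' \<circ> v(x := b)) \<phi>)"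
proof -
  let ?D = "\<lambda>Z :: nat set. {b \<in> B. snd b \<subseteq> (\<lambda>z. z mod 2 ^ n) ` Z}"
  have K: "(2::nat) ^ n > 0" by simp
  obtain P P0 f where P: "conf {..<2 * 2 ^ n} P P0 f"
    "\<forall>Z. Z \<subseteq> {..<2 * 2 ^ n} \<longrightarrow> inj_on (\<lambda>z. z mod 2 ^ n) Z \<longrightarrow>
       lift (2 ^ n) Z ` ?D Z \<subseteq> P \<and> pelem L M M ((\<lambda>b. (e b, f (lift (2 ^ n) Z b))) ` ?D Z)"
    by (rule conf_double[OF K c])
  obtain B' B0' e' where B': "conf {..<2 * 2 ^ n} B' B0' e'" "P \<subseteq> B'" "\<forall>c \<in> P. e' c = f c"
    "\<forall>v. v ` fv (Exists x \<phi>) \<subseteq> P \<longrightarrow> sat M (f \<circ> v) (Exists x \<phi>) \<longrightarrow> (\<exists>b \<in> B'. sat M (e' \<circ> v(x := b)) \<phi>)"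
    by (rule conf_witnesses[OF P(1) \<phi>])
  show thesis
  proof (rule that)
    show "conf {..<2 ^ Suc n} B' B0' e'" using B'(1) by simp
    show "P \<subseteq> B'" by (rule B'(2))
    show "\<forall>Z. Z \<subseteq> {..<2 ^ Suc n} \<longrightarrow> inj_on (\<lambda>z. z mod 2 ^ n) Z \<longrightarrow>
       lift (2 ^ n) Z ` ?D Z \<subseteq> P \<and> pelem L M M ((\<lambda>b. (e b, e' (lift (2 ^ n) Z b))) ` ?D Z)"
    proof (intro allI impI)
      fix Z :: "nat set" assume "Z \<subseteq> {..<2 ^ Suc n}" "inj_on (\<lambda>z. z mod 2 ^ n) Z"
      then have Z: "lift (2 ^ n) Z ` ?D Z \<subseteq> P" "pelem L M M ((\<lambda>b. (e b, f (lift (2 ^ n) Z b))) ` ?D Z)"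
        using P(2) by simp_all
      have "(\<lambda>b. (e b, e' (lift (2 ^ n) Z b))) ` ?D Z = (\<lambda>b. (e b, f (lift (2 ^ n) Z b))) ` ?D Z"
        by (rule image_cong[OF refl]) (use Z(1) B'(3) in blast)
      then show "lift (2 ^ n) Z ` ?D Z \<subseteq> P \<and> pelem L M M ((\<lambda>b. (e b, e' (lift (2 ^ n) Z b))) ` ?D Z)"
        using Z by simp
    qed
    show "\<forall>v. v ` fv (Exists x \<phi>) \<subseteq> P \<longrightarrow> sat M (e' \<circ> v) (Exists x \<phi>) \<longrightarrow> (\<exists>b \<in> B'. sat M (e' \<circ> v(x := b)) \<phi>)"
    proof (intro allI impI)
      fix v assume v: "v ` fv (Exists x \<phi>) \<subseteq> P" "sat M (e' \<circ> v) (Exists x \<phi>)"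
      have "(e' \<circ> v) i = (f \<circ> v) i" if "i \<in> fv (Exists x \<phi>)" for i
        using bspec[OF B'(3), of "v i"] v(1) that by auto
      then have "sat M (f \<circ> v) (Exists x \<phi>)" by (rule iffD1[OF sat_cong v(2)])
      then show "\<exists>b \<in> B'. sat M (e' \<circ> v(x := b)) \<phi>" using B'(4) v(1) by blast
    qed
  qed
qed

end

text \<open>
  \<open>P (Suc n)\<close> consists of the names present after splitting all nodes of level \<open>n\<close>; \<open>B (Suc n)\<close> also
  has witnesses for the formula of \<open>task n\<close>.
\<close>

locale henkin_tree = countable_pseudominimal L T M
  for L :: "('f, 'r) lang" and T and M :: "('a, 'f, 'r) struct" +
  fixes P B B0 :: "nat \<Rightarrow> (nat \<times> nat set) set" and e :: "nat \<Rightarrow> nat \<times> nat set \<Rightarrow> 'a"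
    and task :: "nat \<Rightarrow> nat \<times> ('f, 'r) fm"
  assumes conf: "conf {..<2 ^ n} (B n) (B0 n) (e n)" and PB: "P n \<subseteq> B n"
    and lift_P: "Z \<subseteq> {..<2 ^ Suc n} \<Longrightarrow> inj_on (\<lambda>z. z mod 2 ^ n) Z \<Longrightarrow>
      lift (2 ^ n) Z ` {b \<in> B n. snd b \<subseteq> (\<lambda>z. z mod 2 ^ n) ` Z} \<subseteq> P (Suc n)"
    and lift_pelem: "Z \<subseteq> {..<2 ^ Suc n} \<Longrightarrow> inj_on (\<lambda>z. z mod 2 ^ n) Z \<Longrightarrow>
      pelem L M M ((\<lambda>b. (e n b, e (Suc n) (lift (2 ^ n) Z b))) ` {b \<in> B n. snd b \<subseteq> (\<lambda>z. z mod 2 ^ n) ` Z})"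
    and witness: "task n = (x, \<phi>) \<Longrightarrow> v ` fv (Exists x \<phi>) \<subseteq> P (Suc n) \<Longrightarrow>
      sat M (e (Suc n) \<circ> v) (Exists x \<phi>) \<Longrightarrow> \<exists>b \<in> B (Suc n). sat M (e (Suc n) \<circ> v(x := b)) \<phi>"
    and task: "fm_of L \<phi> \<Longrightarrow> \<exists>n \<ge> m. task n = (x, \<phi>)"
begin

text \<open>Before the name has entered \<open>B n\<close> the values are arbitrary, so statements
  about \<open>seq\<close> hold only eventually.\<close>

definition "seq" :: "nat \<times> (nat \<Rightarrow> bool) set \<Rightarrow> nat \<Rightarrow> 'a" where
  "seq g n = e n (at n g)"

text \<open>Membership in \<open>P n\<close> is asked for, as witnesses are provided for tuples of
  names from there.\<close>

definition valid :: "nat \<times> (nat \<Rightarrow> bool) set \<Rightarrow> bool" where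
  "valid g \<longleftrightarrow> finite (snd g) \<and> (\<forall>\<^sub>F n in sequentially. at n g \<in> P n)"

lemma B_properties: "b \<in> B n \<Longrightarrow> snd b \<subseteq> {..<2 ^ n}" "b \<in> B n \<Longrightarrow> e n b \<in> universe M"
  using conf[of n] unfolding conf_def by blast+

lemma coherent_step:
  assumes F: "inj_on (trunc n) F" and G: "\<And>g. g \<in> G \<Longrightarrow> snd g \<subseteq> F" "\<And>g. g \<in> G \<Longrightarrow> at n g \<in> B n"
  shows "inj_on (trunc (Suc n)) F" "at (Suc n) ` G \<subseteq> P (Suc n)"
    "pelem L M M ((\<lambda>g. (seq g n, seq g (Suc n))) ` G)"
proof -
  show "inj_on (trunc (Suc n)) F"
    using F trunc_Suc_mod[of n] unfolding inj_on_def by metis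
  \<comment> \<open>One successor per branch; since the branches are already separated at level
    \<open>n\<close>, reduction modulo \<open>2 ^ n\<close> is injective on this set.\<close>
  let ?Z = "trunc (Suc n) ` F"
  have im: "(\<lambda>z. z mod 2 ^ n) ` ?Z = trunc n ` F"
    unfolding image_image trunc_Suc_mod ..
  have Z: "?Z \<subseteq> {..<2 ^ Suc n}" using trunc_less by blast
  have inj: "inj_on (\<lambda>z. z mod 2 ^ n) ?Z"
    using F unfolding inj_on_def by (auto simp: trunc_Suc_mod simp del: trunc.simps)
  have D: "at n g \<in> {b \<in> B n. snd b \<subseteq> (\<lambda>z. z mod 2 ^ n) ` ?Z}" if "g \<in> G" for g
    unfolding im using G[OF that] by (auto simp: at_def)
  have at: "at (Suc n) g = lift (2 ^ n) ?Z (at n g)" if "g \<in> G" for g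
    by (rule at_Suc[OF F G(1)[OF that]])
  show "at (Suc n) ` G \<subseteq> P (Suc n)"
  proof (rule image_subsetI)
    fix g assume g: "g \<in> G"
    show "at (Suc n) g \<in> P (Suc n)" unfolding at[OF g] using lift_P[OF Z inj] D[OF g] by blast
  qed
  show "pelem L M M ((\<lambda>g. (seq g n, seq g (Suc n))) ` G)"
  proof (rule pelem_mono[OF lift_pelem[OF Z inj]], rule image_subsetI)
    fix g assume g: "g \<in> G"
    show "(seq g n, seq g (Suc n)) \<in> (\<lambda>b. (e n b, e (Suc n) (lift (2 ^ n) ?Z b))) `
        {b \<in> B n. snd b \<subseteq> (\<lambda>z. z mod 2 ^ n) ` ?Z}"
      unfolding seq_def at[OF g] by (rule imageI[OF D[OF g]])
  qed
qed

text \<open>Once the branches are separated and the names present, both facts persist and the joint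
  type is frozen. A name known only to be in \<open>B m\<close> reaches \<open>P\<close> one level
  later, whence \<open>m < n\<close> in the third claim.\<close>

lemma coherent:
  assumes F: "inj_on (trunc m) F" and G: "\<And>g. g \<in> G \<Longrightarrow> snd g \<subseteq> F" "\<And>g. g \<in> G \<Longrightarrow> at m g \<in> B m"
    and n: "m \<le> n"
  shows "inj_on (trunc n) F" "at n ` G \<subseteq> B n" "m < n \<Longrightarrow> at n ` G \<subseteq> P n"
    "pelem L M M ((\<lambda>g. (seq g m, seq g n)) ` G)"
proof -
  have "inj_on (trunc n) F \<and> at n ` G \<subseteq> B n \<and> (m < n \<longrightarrow> at n ` G \<subseteq> P n) \<and>
    pelem L M M ((\<lambda>g. (seq g m, seq g n)) ` G)"
    using n
  proof (induction n rule: dec_induct)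
    case base
    have "pelem L M M (Id_on ((\<lambda>g. seq g m) ` G))"
      by (rule pelem_Id_on, rule image_subsetI, unfold seq_def, rule B_properties(2)[OF G(2)])
    then have "pelem L M M ((\<lambda>g. (seq g m, seq g m)) ` G)" by (rule pelem_mono) auto
    then show ?case using F G(2) by auto
  next
    case (step n)
    have Gn: "at n g \<in> B n" if "g \<in> G" for g using step.IH that by blast
    note s = coherent_step[OF conjunct1[OF step.IH] G(1) Gn]
    have "pelem L M M ((\<lambda>g. (seq g m, seq g (Suc n))) ` G)"
      by (rule pelem_mono[OF pelem_relcomp[OF _ s(3)]]) (use step.IH in auto)
    then show ?case using s(1,2) PB by blast
  qed
  then show "inj_on (trunc n) F" "at n ` G \<subseteq> B n" "m < n \<Longrightarrow> at n ` G \<subseteq> P n"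
    "pelem L M M ((\<lambda>g. (seq g m, seq g n)) ` G)" by blast+
qed

lemma validI:
  assumes "inj_on (trunc m) (snd g)" "at m g \<in> B m" shows "valid g"
proof -
  have "finite (trunc m ` snd g)"
    using B_properties(1)[OF assms(2)] finite_subset[OF _ finite_lessThan] by (simp add: at_def)
  then have "finite (snd g)" by (rule finite_imageD[OF _ assms(1)])
  moreover have "at n g \<in> P n" if "n \<ge> Suc m" for n
    using coherent(3)[of m "snd g" "{g}" n] assms that by auto
  ultimately show ?thesis unfolding valid_def eventually_sequentially by blast
qed

lemma eventually_coherent:
  assumes G: "finite G" "\<And>g. g \<in> G \<Longrightarrow> valid g"
  shows "\<forall>\<^sub>F n in sequentially. inj_on (trunc n) (\<Union>g \<in> G. snd g) \<and> at n ` G \<subseteq> P n"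
proof -
  have "\<forall>\<^sub>F n in sequentially. \<forall>g \<in> G. at n g \<in> P n"
    by (rule eventually_ball_finite) (use G in \<open>auto simp: valid_def\<close>)
  moreover have "\<forall>\<^sub>F n in sequentially. inj_on (trunc n) (\<Union>g \<in> G. snd g)"
    by (rule eventually_inj_on_trunc) (use G in \<open>auto simp: valid_def\<close>)
  ultimately show ?thesis by eventually_elim auto
qed

lemma seq_stable:
  assumes "finite S" "S \<subseteq> seq ` Collect valid"
  shows "\<exists>m. \<forall>n \<ge> m. pelem L M M ((\<lambda>s. (s m, s n)) ` S)"
proof -
  obtain G where G: "G \<subseteq> Collect valid" "finite G" "S = seq ` G"
    using finite_subset_image[OF assms] by blast
  have "\<forall>\<^sub>F n in sequentially. inj_on (trunc n) (\<Union>g \<in> G. snd g) \<and> at n ` G \<subseteq> P n"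
    by (rule eventually_coherent[OF G(2)]) (use G(1) in blast)
  then obtain m where m: "inj_on (trunc m) (\<Union>g \<in> G. snd g)" "at m ` G \<subseteq> P m"
    unfolding eventually_sequentially by blast
  have "pelem L M M ((\<lambda>g. (seq g m, seq g n)) ` G)" if "n \<ge> m" for n
    by (rule coherent(4)[OF m(1) _ _ that]) (use m(2) PB in blast)+
  then show ?thesis unfolding G(3) image_image by blast
qed

text \<open>A stage is awaited at which the parameters are coherent and the formula is due. The
  witness found there is the name of a finite set of nodes; running a branch through each of them
  makes it a name of the limit.\<close>

lemma seq_witness:
  assumes \<phi>: "fm_of L \<phi>" "v ` fv (Exists x \<phi>) \<subseteq> seq ` Collect valid"
    and ev: "\<forall>\<^sub>F n in sequentially. sat M (\<lambda>i. v i n) (Exists x \<phi>)"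
  shows "\<exists>s \<in> seq ` Collect valid. \<forall>\<^sub>F n in sequentially. sat M ((\<lambda>i. v i n)(x := s n)) \<phi>"
proof -
  let ?A = "fv (Exists x \<phi>)"
  have "\<forall>i. \<exists>g. i \<in> ?A \<longrightarrow> valid g \<and> v i = seq g" using \<phi>(2) by fastforce
  then obtain w where w: "\<And>i. i \<in> ?A \<Longrightarrow> valid (w i) \<and> v i = seq (w i)" by metis
  let ?G = "w ` ?A"
  let ?F = "\<Union>g \<in> ?G. snd g"
  have "\<forall>\<^sub>F n in sequentially. inj_on (trunc n) ?F \<and> at n ` ?G \<subseteq> P n"
    by (rule eventually_coherent) (use w finite_fv[of "Exists x \<phi>"] in blast)+
  with ev have "\<forall>\<^sub>F n in sequentially. inj_on (trunc n) ?F \<and> at n ` ?G \<subseteq> P n \<and> sat M (\<lambda>i. v i n) (Exists x \<phi>)"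
    by eventually_elim blast
  then obtain k where k: "\<And>n. n \<ge> k \<Longrightarrow> inj_on (trunc n) ?F \<and> at n ` ?G \<subseteq> P n \<and> sat M (\<lambda>i. v i n) (Exists x \<phi>)"
    unfolding eventually_sequentially by blast
  obtain n0 where n0: "n0 \<ge> k" "task n0 = (x, \<phi>)" using task[OF \<phi>(1)] by blast
  \<comment> \<open>The witnesses for \<open>task n0\<close> enter when level \<open>Suc n0\<close>
    is formed.\<close>
  define n where "n = Suc n0"
  have n: "inj_on (trunc n) ?F" "at n ` ?G \<subseteq> P n" "sat M (\<lambda>i. v i n) (Exists x \<phi>)"
    using k[of n] n0(1) by (auto simp: n_def)
  let ?v = "\<lambda>i. at n (w i)"
  have vP: "?v ` ?A \<subseteq> P n" using n(2) by blast
  have "sat M (e n \<circ> ?v) (Exists x \<phi>)"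
    by (rule iffD1[OF sat_cong n(3)]) (use w in \<open>simp add: seq_def\<close>)
  then obtain b where b: "b \<in> B n" "sat M (e n \<circ> ?v(x := b)) \<phi>"
    using witness[OF n0(2)] vP unfolding n_def by blast
  \<comment> \<open>A node already on a branch of \<open>?F\<close> keeps that branch, so that all
    branches involved stay separated at level \<open>n\<close>; any other node gets the branch of
    its binary digits, which is eventually zero.\<close>
  define pick where "pick z = (if z \<in> trunc n ` ?F then inv_into ?F (trunc n) z else bit z)" for z
  have pick: "trunc n (pick z) = z" if "z \<in> snd b" for z
  proof (cases "z \<in> trunc n ` ?F")
    case True
    then show ?thesis unfolding pick_def by (simp add: f_inv_into_f)
  next
    case False
    have "z < 2 ^ n" using B_properties(1)[OF b(1)] that by blast
    then show ?thesis using False unfolding pick_def by (simp add: trunc_bit)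
  qed
  define h where "h = (fst b, pick ` snd b)"
  have ath: "at n h = b"
  proof -
    have "trunc n ` pick ` snd b = snd b" using pick by (simp add: image_image)
    then show ?thesis by (simp add: at_def h_def)
  qed
  have inj: "inj_on (trunc n) (?F \<union> snd h)"
  proof (rule inj_on_inverseI)
    fix \<sigma> assume "\<sigma> \<in> ?F \<union> snd h"
    then consider "\<sigma> \<in> ?F" | z where "z \<in> snd b" "\<sigma> = pick z" by (auto simp: h_def)
    then show "pick (trunc n \<sigma>) = \<sigma>"
    proof cases
      case 1
      then show ?thesis unfolding pick_def using inv_into_f_f[OF n(1) 1] by auto
    next
      case 2
      then show ?thesis using pick by simp
    qed
  qed
  have vh: "valid h" by (rule validI[of n]) (use inj ath b(1) in \<open>auto intro: inj_on_subset\<close>)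
  have "sat M ((\<lambda>i. v i n')(x := seq h n')) \<phi>" if n': "n' \<ge> n" for n'
  proof -
    have p: "pelem L M M ((\<lambda>g. (seq g n, seq g n')) ` insert h ?G)"
    proof (rule coherent(4)[OF inj _ _ n'])
      show "snd g \<subseteq> ?F \<union> snd h" if "g \<in> insert h ?G" for g using that by blast
      show "at n g \<in> B n" if "g \<in> insert h ?G" for g
        using that ath b(1) n(2) PB by blast
    qed
    have "sat M (e n \<circ> ?v(x := b)) \<phi> = sat M ((\<lambda>i. v i n')(x := seq h n')) \<phi>"
    proof (rule pelem_sat[OF p \<phi>(1)])
      fix i assume i: "i \<in> fv \<phi>"
      show "((e n \<circ> ?v(x := b)) i, ((\<lambda>i. v i n')(x := seq h n')) i) \<in> (\<lambda>g. (seq g n, seq g n')) ` insert h ?G"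
      proof (cases "i = x")
        case True
        then show ?thesis using ath by (simp add: seq_def)
      next
        case False
        then have "i \<in> ?A" using i by simp
        then have "w i \<in> insert h ?G" "v i = seq (w i)" using w by blast+
        then show ?thesis using False by (intro image_eqI[of _ _ "w i"]) (simp_all add: seq_def)
      qed
    qed
    then show ?thesis using b(2) by simp
  qed
  then show ?thesis using vh unfolding eventually_sequentially by blast
qed

lemma valid_branch: "valid (0, {\<sigma>})"
proof (rule validI[of 0])
  have "(0, {0}) \<in> B 0" using conf[of 0] unfolding conf_def by auto
  then show "at 0 (0, {\<sigma>}) \<in> B 0" by (simp add: at_def)
qed simp

text \<open>Different branches eventually pass through different nodes, whose base names have
  different values because \<open>e n\<close> is injective on the base.\<close>

lemma seq_branch_eqD:
  assumes "\<forall>\<^sub>F n in sequentially. seq (0, {\<sigma>}) n = seq (0, {\<tau>}) n"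
  shows "\<sigma> = \<tau>"
proof (rule ccontr)
  assume "\<sigma> \<noteq> \<tau>"
  then have "\<forall>\<^sub>F n in sequentially. trunc n \<sigma> \<noteq> trunc n \<tau>" by (rule eventually_trunc_neq)
  with assms have "\<forall>\<^sub>F n :: nat in sequentially. False"
  proof eventually_elim
    case (elim n)
    have "inj_on (e n) (B0 n)" "(0, {trunc n \<sigma>}) \<in> B0 n" "(0, {trunc n \<tau>}) \<in> B0 n"
      using conf[of n] trunc_less unfolding conf_def by blast+
    then show False using elim inj_onD[of "e n" "B0 n" "(0, {trunc n \<sigma>})" "(0, {trunc n \<tau>})"]
      by (simp add: seq_def at_def)
  qed
  then show False by simp
qed

end

section \<open>Atomicity and cardinality of the limit\<close>

lemma card_of_continuum: "|UNIV :: (nat \<Rightarrow> bool) set| =o ctwo ^c natLeq"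
proof -
  have "Func (UNIV :: nat set) (UNIV :: bool set) = UNIV" by (auto simp: Func_def)
  then have "ctwo ^c natLeq = |UNIV :: (nat \<Rightarrow> bool) set|"
    by (simp add: cexp_def ctwo_def Field_natLeq Field_card_of)
  then show ?thesis by (simp add: card_of_refl)
qed

lemma card_of_nat_set_continuum:
  fixes A :: "nat set set"
  assumes "inj_on f (UNIV :: (nat \<Rightarrow> bool) set)" "range f \<subseteq> A"
  shows "|A| =o ctwo ^c natLeq"
proof -
  have "|UNIV :: (nat \<Rightarrow> bool) set| \<le>o |A|" using assms card_of_ordLeq by blast
  moreover have "|A| \<le>o |UNIV :: (nat \<Rightarrow> bool) set|"
  proof (rule card_of_ordLeqI)
    show "inj_on (\<lambda>X n. n \<in> X) A" by (rule inj_onI) (metis Collect_mem_eq)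
  qed simp
  ultimately show ?thesis using ordIso_iff_ordLeq ordIso_transitive[OF _ card_of_continuum] by blast
qed

context henkin_tree
begin

lemma continuum_model:
  "\<exists>N :: (nat set, 'f, 'r) struct. atomic_model L T N \<and> |universe N| =o ctwo ^c natLeq"
proof -
  let ?S = "seq ` Collect valid"
  have ne: "?S \<noteq> {}" using valid_branch by blast
  obtain N :: "(nat \<Rightarrow> 'a, 'f, 'r) struct" and r where N: "structure_of L N" "universe N \<subseteq> ?S"
    "\<forall>s \<in> ?S. r s \<in> universe N \<and> (\<forall>\<^sub>F n in sequentially. s n = r s n)"
    "\<forall>\<phi> v. fm_of L \<phi> \<longrightarrow> v ` fv \<phi> \<subseteq> universe N \<longrightarrow>
       sat N v \<phi> = (\<forall>\<^sub>F n in sequentially. sat M (\<lambda>i. v i n) \<phi>)"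
    by (rule limit_model[OF structure_M ne seq_stable seq_witness])
  have sat: "sat N v \<phi> = (\<forall>\<^sub>F n in sequentially. sat M (\<lambda>i. v i n) \<phi>)"
    if "fm_of L \<phi>" "v ` fv \<phi> \<subseteq> universe N" for \<phi> v using N(4) that by blast
  have stab: "\<exists>m. \<forall>n \<ge> m. pelem L M M ((\<lambda>s. (s m, s n)) ` G)" if "finite G" "G \<subseteq> universe N" for G
    by (rule seq_stable[OF that(1) order_trans[OF that(2) N(2)]])
  have N_eq: "s = t" if st: "s \<in> universe N" "t \<in> universe N" and ev: "\<forall>\<^sub>F n in sequentially. s n = t n" for s t
  proof -
    let ?v = "\<lambda>i. if i = 0 then s else t" and ?\<phi> = "Eq (Var 0) (Var 1)"
    have "sat N ?v ?\<phi> = (\<forall>\<^sub>F n in sequentially. sat M (\<lambda>i. ?v i n) ?\<phi>)"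
      by (rule sat) (use st in auto)
    then show ?thesis using ev by simp
  qed
  have atomic: "atomic_model L T N"
    unfolding atomic_model_def models_def
  proof (intro conjI ballI allI impI)
    fix \<sigma> and v :: "nat \<Rightarrow> nat \<Rightarrow> 'a" assume \<sigma>: "\<sigma> \<in> T"
    have s: "fm_of L \<sigma>" "fv \<sigma> = {}" using theory_T \<sigma> by (auto simp: theory_of_def sentence_of_def)
    obtain a where a: "a \<in> universe M" using structure_M by (auto simp: structure_of_def)
    have "range (\<lambda>_::nat. a) \<subseteq> universe M" using a by auto
    then have "sat M (\<lambda>_. a) \<sigma>" using models_M \<sigma> unfolding models_def by blast
    moreover have "sat M (\<lambda>i. v i n) \<sigma> = sat M (\<lambda>_. a) \<sigma>" for n by (rule sat_cong) (simp add: s)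
    ultimately show "sat N v \<sigma>" using sat[of \<sigma> v] s by simp
  next
    fix xs assume xs: "xs \<in> lists (universe N)"
    \<comment> \<open>From \<open>m\<close> on the type of the tuple is constant, so the complete
      formula found at stage \<open>m\<close> holds eventually and therefore in
      \<open>N\<close>.\<close>
    obtain m where m: "\<And>n. n \<ge> m \<Longrightarrow> pelem L M M ((\<lambda>s. (s m, s n)) ` set xs)"
      using stab[of "set xs"] xs by auto
    let ?ys = "map (\<lambda>s. s m) xs"
    have "s m \<in> universe M" if "s \<in> set xs" for s
      using m[of m] that unfolding pelem_def by auto
    then have "?ys \<in> lists (universe M)" by auto
    then obtain \<phi> where \<phi>: "complete_fm L T (length ?ys) \<phi>" "sat M (nth ?ys) \<phi>"
      using atomic_M unfolding atomic_model_def by blast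
    have f: "fm_of L \<phi>" "\<And>i. i \<in> fv \<phi> \<Longrightarrow> i < length xs" using \<phi>(1) by (auto simp: complete_fm_def)
    have "sat M (\<lambda>i. (xs ! i) n) \<phi>" if "n \<ge> m" for n
    proof -
      have "sat M (nth ?ys) \<phi> = sat M (\<lambda>i. (xs ! i) n) \<phi>"
      proof (rule pelem_sat[OF m[OF that] f(1)])
        fix i assume "i \<in> fv \<phi>"
        then have i: "i < length xs" by (rule f(2))
        show "(?ys ! i, (xs ! i) n) \<in> (\<lambda>s. (s m, s n)) ` set xs"
          by (rule image_eqI[of _ _ "xs ! i"]) (use i in simp_all)
      qed
      then show ?thesis using \<phi>(2) by simp
    qed
    then have "\<forall>\<^sub>F n in sequentially. sat M (\<lambda>i. (xs ! i) n) \<phi>" unfolding eventually_sequentially by blast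
    moreover have "nth xs ` fv \<phi> \<subseteq> universe N" using f(2) xs by (auto simp: in_lists_conv_set)
    ultimately have "sat N (nth xs) \<phi>" using sat[OF f(1)] by blast
    then show "\<exists>\<phi>. complete_fm L T (length xs) \<phi> \<and> sat N (nth xs) \<phi>" using \<phi>(1) by auto
  qed (rule N(1))
  \<comment> \<open>The graph of a sequence, coded as a set of numbers, gives the required universe
    type. Values outside \<open>universe M\<close> need not be coded faithfully, so equal codes
    yield eventual equality, which \<open>N_eq\<close> turns into equality.\<close>
  define h :: "(nat \<Rightarrow> 'a) \<Rightarrow> nat set" where
    "h s = (\<lambda>n. prod_encode (n, to_nat_on (universe M) (s n))) ` UNIV" for s
  have inj: "inj_on h (universe N)"
  proof (rule inj_onI)
    fix s t assume st: "s \<in> universe N" "t \<in> universe N" and eq: "h s = h t"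
    have code: "to_nat_on (universe M) (s n) = to_nat_on (universe M) (t n)" for n
    proof -
      have "prod_encode (n, to_nat_on (universe M) (s n)) \<in> h t" using eq unfolding h_def by blast
      then show ?thesis unfolding h_def by (auto simp: prod_encode_eq)
    qed
    obtain m where m: "\<And>n. n \<ge> m \<Longrightarrow> pelem L M M ((\<lambda>s. (s m, s n)) ` {s, t})"
      using stab[of "{s, t}"] st by auto
    have "s n = t n" if "n \<ge> m" for n
    proof -
      have "s n \<in> universe M" "t n \<in> universe M" using m[OF that] unfolding pelem_def by auto
      then show ?thesis using code[of n] countable_M by simp
    qed
    then show "s = t" using N_eq[OF st] unfolding eventually_sequentially by blast
  qed
  obtain N' :: "(nat set, 'f, 'r) struct" where N': "structure_of L N'" "universe N' = h ` universe N"
    "\<And>\<phi> v. fm_of L \<phi> \<Longrightarrow> range v \<subseteq> universe N \<Longrightarrow> sat N' (h \<circ> v) \<phi> = sat N v \<phi>"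
    using isomorphic_copy[OF N(1) inj] by metis
  have "atomic_model L T N'"
  proof (rule atomic_model_pelem[OF theory_T atomic N'(1)])
    let ?R = "(\<lambda>s. (h s, s)) ` universe N"
    show "universe N' \<subseteq> Domain ?R" using N'(2) by auto
    show "pelem L N' N ?R"
    proof (rule pelemI)
      show "?R \<subseteq> universe N' \<times> universe N" using N'(2) by auto
      fix \<phi> :: "('f, 'r) fm" and v assume \<phi>: "fm_of L \<phi>" "v ` fv \<phi> \<subseteq> ?R"
      obtain u where u: "u \<in> universe N" using N(1) by (auto simp: structure_of_def)
      let ?w = "\<lambda>i. if i \<in> fv \<phi> then snd (v i) else u"
      have v: "snd (v i) \<in> universe N \<and> fst (v i) = h (snd (v i))" if "i \<in> fv \<phi>" for i
        using \<phi>(2) that by force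
      have "sat N' (fst \<circ> v) \<phi> = sat N' (h \<circ> ?w) \<phi>" by (rule sat_cong) (use v in simp)
      also have "\<dots> = sat N ?w \<phi>" by (rule N'(3)[OF \<phi>(1)]) (use u v in auto)
      also have "\<dots> = sat N (snd \<circ> v) \<phi>" by (rule sat_cong) simp
      finally show "sat N' (fst \<circ> v) \<phi> = sat N (snd \<circ> v) \<phi>" .
    qed
  qed
  moreover have "|universe N'| =o ctwo ^c natLeq"
  proof (rule card_of_nat_set_continuum)
    let ?b = "\<lambda>\<sigma>. r (seq (0, {\<sigma>}))"
    have b: "?b \<sigma> \<in> universe N" "\<forall>\<^sub>F n in sequentially. seq (0, {\<sigma>}) n = ?b \<sigma> n" for \<sigma>
      using N(3) valid_branch by blast+
    show "range (\<lambda>\<sigma>. h (?b \<sigma>)) \<subseteq> universe N'" using b(1) N'(2) by blast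
    show "inj (\<lambda>\<sigma>. h (?b \<sigma>))"
    proof (rule injI)
      fix \<sigma> \<tau> assume "h (?b \<sigma>) = h (?b \<tau>)"
      then have eq: "?b \<sigma> = ?b \<tau>" using inj_onD[OF inj _ b(1) b(1)] by blast
      have "\<forall>\<^sub>F n in sequentially. seq (0, {\<sigma>}) n = seq (0, {\<tau>}) n"
        using b(2)[of \<sigma>] b(2)[of \<tau>] by eventually_elim (simp add: eq)
      then show "\<sigma> = \<tau>" by (rule seq_branch_eqD)
    qed
  qed
  ultimately show ?thesis by blast
qed

end

section \<open>Existence of the tree\<close>

context countable_pseudominimal
begin

lemma exists_henkin_tree:
  assumes a: "a \<in> universe M" "a \<notin> cl {}"
  obtains P B B0 e task where "henkin_tree L T M P B B0 e task"
proof -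
  let ?F = "(UNIV :: nat set) \<times> {\<phi>. fm_of L \<phi>}"
  \<comment> \<open>Using one component of the decoded pair makes every formula due infinitely
    often, hence also for tuples that appear late.\<close>
  define task where "task n = from_nat_into ?F (fst (prod_decode n))" for n
  have F: "countable ?F" "?F \<noteq> {}"
    using countable_fm_of[OF countable_L] by (auto intro: exI[of _ "Eq (Var 0) (Var 0)"])
  have task_ex: "\<exists>n \<ge> m. task n = (x, \<phi>)" if "fm_of L \<phi>" for m x \<phi>
  proof -
    have "(x, \<phi>) \<in> ?F" using that by simp
    then obtain k where k: "from_nat_into ?F k = (x, \<phi>)" using from_nat_into_surj[OF F(1)] by blast
    then have "task (prod_encode (k, m)) = (x, \<phi>)" by (simp add: task_def)
    then show ?thesis using le_prod_encode_2 by blast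
  qed
  have task_fm: "fm_of L (snd (task n))" for n
    using from_nat_into[OF F(2), of "fst (prod_decode n)"] unfolding task_def by auto
  define ok where "ok n D \<longleftrightarrow> (case D of (P, B, B0, e) \<Rightarrow> conf {..<2 ^ n} B B0 e \<and> P \<subseteq> B)" for n and
    D :: "(nat \<times> nat set) set \<times> (nat \<times> nat set) set \<times> (nat \<times> nat set) set \<times> (nat \<times> nat set \<Rightarrow> 'a)"
  define step where "step n D D' \<longleftrightarrow> (case D of (P, B, B0, e) \<Rightarrow> case D' of (P', B', B0', e') \<Rightarrow>
      (\<forall>Z. Z \<subseteq> {..<2 ^ Suc n} \<longrightarrow> inj_on (\<lambda>z. z mod 2 ^ n) Z \<longrightarrow>
         lift (2 ^ n) Z ` {b \<in> B. snd b \<subseteq> (\<lambda>z. z mod 2 ^ n) ` Z} \<subseteq> P' \<and>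
         pelem L M M ((\<lambda>b. (e b, e' (lift (2 ^ n) Z b))) ` {b \<in> B. snd b \<subseteq> (\<lambda>z. z mod 2 ^ n) ` Z})) \<and>
      (\<forall>v. v ` fv (Exists (fst (task n)) (snd (task n))) \<subseteq> P' \<longrightarrow>
         sat M (e' \<circ> v) (Exists (fst (task n)) (snd (task n))) \<longrightarrow>
         (\<exists>b \<in> B'. sat M (e' \<circ> v(fst (task n) := b)) (snd (task n)))))"
    for n and D D' :: "(nat \<times> nat set) set \<times> (nat \<times> nat set) set \<times> (nat \<times> nat set) set \<times> (nat \<times> nat set \<Rightarrow> 'a)"
  have "\<exists>D. \<forall>n. ok n (D n) \<and> step n (D n) (D (Suc n))"
  proof (rule dependent_nat_choice)
    \<comment> \<open>The start is a single node carrying \<open>a\<close>; independence of its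
      value is the assumption that \<open>a\<close> lies outside the closure of the empty
      set.\<close>
    let ?B = "{(0, {0 :: nat})} :: (nat \<times> nat set) set"
    have "(\<lambda>_. a) ` {c \<in> ?B. snd c \<subseteq> snd b} = {a}" if "b \<in> ?B" for b using that by auto
    then have "conf {..<2 ^ 0} ?B ?B (\<lambda>_. a)"
      using a pcl_superset[of "{a}" M L] unfolding conf_def indep_def by simp
    then show "\<exists>D. ok 0 D" by (intro exI[of _ "({}, ?B, ?B, \<lambda>_. a)"]) (simp add: ok_def)
  next
    fix n D assume "ok n D"
    then obtain P B B0 e where D: "D = (P, B, B0, e)" "conf {..<2 ^ n} B B0 e"
      by (cases D) (auto simp: ok_def)
    obtain P' B' B0' e' where "conf {..<2 ^ Suc n} B' B0' e'" "P' \<subseteq> B'"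
      "\<forall>Z. Z \<subseteq> {..<2 ^ Suc n} \<longrightarrow> inj_on (\<lambda>z. z mod 2 ^ n) Z \<longrightarrow>
         lift (2 ^ n) Z ` {b \<in> B. snd b \<subseteq> (\<lambda>z. z mod 2 ^ n) ` Z} \<subseteq> P' \<and>
         pelem L M M ((\<lambda>b. (e b, e' (lift (2 ^ n) Z b))) ` {b \<in> B. snd b \<subseteq> (\<lambda>z. z mod 2 ^ n) ` Z})"
      "\<forall>v. v ` fv (Exists (fst (task n)) (snd (task n))) \<subseteq> P' \<longrightarrow>
         sat M (e' \<circ> v) (Exists (fst (task n)) (snd (task n))) \<longrightarrow>
         (\<exists>b \<in> B'. sat M (e' \<circ> v(fst (task n) := b)) (snd (task n)))"
      by (rule conf_step[OF D(2) task_fm])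
    then show "\<exists>D'. ok (Suc n) D' \<and> step n D D'"
      unfolding D(1) ok_def step_def by (intro exI[of _ "(P', B', B0', e')"]) (simp only: prod.case)
  qed
  then obtain D where D: "\<And>n. ok n (D n)" "\<And>n. step n (D n) (D (Suc n))" by blast
  define P where "P n = fst (D n)" for n
  define B where "B n = fst (snd (D n))" for n
  define B0 where "B0 n = fst (snd (snd (D n)))" for n
  define e where "e n = snd (snd (snd (D n)))" for n
  have Dn: "D n = (P n, B n, B0 n, e n)" for n by (simp add: P_def B_def B0_def e_def)
  have ok: "conf {..<2 ^ n} (B n) (B0 n) (e n)" "P n \<subseteq> B n" for n
    using D(1)[of n] unfolding ok_def Dn prod.case by blast+
  have st: "(\<forall>Z. Z \<subseteq> {..<2 ^ Suc n} \<longrightarrow> inj_on (\<lambda>z. z mod 2 ^ n) Z \<longrightarrow>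
         lift (2 ^ n) Z ` {b \<in> B n. snd b \<subseteq> (\<lambda>z. z mod 2 ^ n) ` Z} \<subseteq> P (Suc n) \<and>
         pelem L M M ((\<lambda>b. (e n b, e (Suc n) (lift (2 ^ n) Z b))) ` {b \<in> B n. snd b \<subseteq> (\<lambda>z. z mod 2 ^ n) ` Z}))"
    "(\<forall>v. v ` fv (Exists (fst (task n)) (snd (task n))) \<subseteq> P (Suc n) \<longrightarrow>
         sat M (e (Suc n) \<circ> v) (Exists (fst (task n)) (snd (task n))) \<longrightarrow>
         (\<exists>b \<in> B (Suc n). sat M (e (Suc n) \<circ> v(fst (task n) := b)) (snd (task n))))" for n
    using D(2)[of n] unfolding step_def Dn prod.case by (rule conjunct1, rule conjunct2)
  have "henkin_tree L T M P B B0 e task"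
  proof unfold_locales
    fix n x \<phi> v assume t: "task n = (x, \<phi>)" and v: "v ` fv (Exists x \<phi>) \<subseteq> P (Suc n)"
      "sat M (e (Suc n) \<circ> v) (Exists x \<phi>)"
    then show "\<exists>b \<in> B (Suc n). sat M (e (Suc n) \<circ> v(x := b)) \<phi>"
      using st(2)[of n] unfolding t fst_conv snd_conv by blast
  next
    fix Z :: "nat set" and n assume Z: "Z \<subseteq> {..<2 ^ Suc n}" "inj_on (\<lambda>z. z mod 2 ^ n) Z"
    show "lift (2 ^ n) Z ` {b \<in> B n. snd b \<subseteq> (\<lambda>z. z mod 2 ^ n) ` Z} \<subseteq> P (Suc n)"
      "pelem L M M ((\<lambda>b. (e n b, e (Suc n) (lift (2 ^ n) Z b))) ` {b \<in> B n. snd b \<subseteq> (\<lambda>z. z mod 2 ^ n) ` Z})"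
      using st(1)[of n] Z by blast+
  qed (fact ok task_ex)+
  then show thesis by (rule that)
qed

end

theorem theorem6p3p4:
  fixes L :: "('f, 'r) lang" and T :: "('f, 'r) fm set" and M :: "('a, 'f, 'r) struct"
  assumes "countable_lang L"
    and "complete_theory L T"
    and "atomic_model L T M"
    and "pseudominimal L M"
    and "|universe M| =o cardSuc natLeq"
  shows "\<exists>N :: (nat set, 'f, 'r) struct.
           atomic_model L T N \<and> pseudominimal L N \<and> |universe N| =o ctwo ^c natLeq"
proof -
  interpret complete_countable_theory L T by unfold_locales (rule assms)+
  have st: "structure_of L M" using assms(3) by (simp add: atomic_model_def models_def)
  have unc: "uncountable (universe M)"
  proof
    assume "countable (universe M)"
    then obtain f :: "'a \<Rightarrow> nat" where "inj_on f (universe M)" by (rule countableE)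
    then have "|universe M| \<le>o |UNIV :: nat set|" using card_of_ordLeqI[of f] by blast
    then have "|universe M| \<le>o natLeq" using card_of_nat ordLeq_ordIso_trans by blast
    then have "cardSuc natLeq \<le>o natLeq"
      using ordIso_ordLeq_trans[OF ordIso_symmetric[OF assms(5)]] by blast
    then show False using cardSuc_greater[OF natLeq_Card_order] not_ordLess_ordLeq by blast
  qed
  obtain m where m: "m \<in> universe M" using st by (auto simp: structure_of_def)
  obtain K0 where K0: "elem_substructure L K0 M" "countable (universe K0)"
    by (rule downward_LS[OF assms(1) st, of "{m}"]) (use m in auto)
  \<comment> \<open>\<open>K0\<close> contains the empty set and omits \<open>a\<close>, so it
    witnesses that \<open>a\<close> is outside \<open>pcl L M {}\<close>.\<close>
  obtain a where a: "a \<in> universe M" "a \<notin> universe K0"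
    using unc countable_subset[OF _ K0(2), of "universe M"] by blast
  have "a \<notin> pcl L M {}" using K0(1) a(2) unfolding pcl_def by blast
  \<comment> \<open>A second countable submodel, now around \<open>a\<close>; its closure of the
    empty set agrees on \<open>a\<close> with that of \<open>M\<close>.\<close>
  obtain K where K: "elem_substructure L K M" "{a} \<subseteq> universe K" "countable (universe K)"
    by (rule downward_LS[OF assms(1) st, of "{a}"]) (use a in auto)
  have aK: "a \<in> universe K" using K(2) by simp
  have "a \<notin> pcl L K {}"
    using pcl_elem_substructure[OF assms(3) K(1,3) aK, of "{}"] \<open>a \<notin> pcl L M {}\<close> by simp
  have atK: "atomic_model L T K" by (rule atomic_elem_substructure[OF assms(3) K(1)])
  interpret countable_pseudominimal L T K
    by unfold_locales (rule atK K(3) pseudominimal_transfer[OF assms(3,4) atK])+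
  obtain P B B0 e task where "henkin_tree L T K P B B0 e task"
    by (rule exists_henkin_tree[OF aK \<open>a \<notin> pcl L K {}\<close>])
  then obtain N :: "(nat set, 'f, 'r) struct" where N: "atomic_model L T N" "|universe N| =o ctwo ^c natLeq"
    using henkin_tree.continuum_model by blast
  then show ?thesis using pseudominimal_transfer[OF assms(3,4) N(1)] by blast
qed

end
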